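(* Let $\vartheta\colon\mathcal{Q}\to\mathcal{R}$ be a lax homomorphism of small quantaloids, let $\mathbb{T}=(T,m,e)$ be a monad on $\mathbf{Set}$, lifted to $\mathbf{Set}/\mathcal{Q}_0$ and $\mathbf{Set}/\mathcal{R}_0$ via $\mathbb{T}$-algebra structures $\zeta\colon T\mathcal{Q}_0\to\mathcal{Q}_0$ and $\eta\colon T\mathcal{R}_0\to\mathcal{R}_0$, respectively, such that $\vartheta_0\colon\mathcal{Q}_0\to\mathcal{R}_0$ is a $\mathbb{T}$-homomorphism. Let $\hat{T},\check{T}$ be lax extensions of $\mathbb{T}$ to $\mathcal{Q}\text{-}\mathbf{Rel}$ and $\mathcal{R}\text{-}\mathbf{Rel}$, with corresponding monotone distributive laws $\lambda$ and $\kappa$, respectively. If $$\check{T}\tilde{B}_{\vartheta}\varphi\le\tilde{B}_{\vartheta}\hat{T}\varphi\qquad(\star)$$ for all $\varphi\colon X\nrightarrow Y$ in $\mathcal{Q}\text{-}\mathbf{Rel}$, then one obtains a functor (the change-of-base functor) $$B_{\vartheta}\colon(\mathbb{T},\hat{T},\mathcal{Q})\text{-}\mathbf{Cat}\to(\mathbb{T},\check{T},\mathcal{R})\text{-}\mathbf{Cat},\quad(X,\alpha)\mapsto(B_{\vartheta_0}X,\tilde{B}_{\vartheta}\alpha).$$ Under the (equivalent) hypothesis $\kappa B_{\vartheta_0}\cdot T\vartheta\le\vartheta T\cdot B_{\vartheta_0}\lambda$ $(\star\star)$, that is, $\kappa_{B_{\vartheta_0}X}\cdot T\vartheta_X\le\vartheta_{TX}\cdot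 B_{\vartheta_0}\lambda_X$ for all $X\in\mathbf{Set}/\mathcal{Q}_0$, this functor is equivalently described as $$B_{\vartheta}\colon(\lambda,\mathcal{Q})\text{-}\mathbf{Alg}\to(\kappa,\mathcal{R})\text{-}\mathbf{Alg},\quad(X,p)\mapsto(B_{\vartheta_0}X,\vartheta_X\cdot B_{\vartheta_0}p).$$
   Context: A quantaloid is a category whose hom-sets are complete lattices and whose composition preserves arbitrary suprema in each variable; the object set of $\mathcal{Q}$ is $\mathcal{Q}_0$, and $\bot$ denotes bottom elements of hom-sets. A lax homomorphism $\vartheta\colon\mathcal{Q}\to\mathcal{R}$ consists of an object map $\vartheta_0\colon\mathcal{Q}_0\to\mathcal{R}_0$ and monotone maps of hom-sets with $1_{\vartheta t}\le\vartheta1_t$ and $\vartheta v\circ\vartheta u\le\vartheta(v\circ u)$. For a small quantaloid $\mathcal{Q}$: objects of $\mathbf{Set}/\mathcal{Q}_0$ are sets $X$ with an array map $|\cdot|_X\colon X\to\mathcal{Q}_0$; morphisms are array-preserving maps. A $\mathcal{Q}$-relation $\varphi\colon X\nrightarrow Y$ is a family of $\mathcal{Q}$-morphisms $\varphi(x,y)\colon|x|\to|y|$; these form $\mathcal{Q}\text{-}\mathbf{Rel}$ with $(\psi\circ\varphi)(x,z)=\bigvee_{y}\psi(y,z)\circ\varphi(x,y)$ and pointwise order. For $f\colon X\to Y$, $f^\circ\colon Y\nrightarrow X$ is $f^\circ(y,x)=1_{|x|}$ if $f(x)=y$, $\bot$ otherwise; $1_X^\circ$ is the identity $\mathcal{Q}$-relation.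 The discrete presheaf monad $\mathbb{P}_{\mathcal{Q}}=(\mathsf{P}_{\mathcal{Q}},\mathsf{s},\mathsf{y})$: $\mathsf{P}_{\mathcal{Q}}X$ is the set of all families $\sigma=(\sigma_x\colon|x|\to s)_{x\in X}$ with specified common codomain $s=:|\sigma|$ (the array of $\sigma$), ordered by $\sigma\le\sigma'$ iff $|\sigma|=|\sigma'|$ and $\sigma_x\le\sigma'_x$ for all $x$; maps into $\mathsf{P}_{\mathcal{Q}}X$ are ordered pointwise; $\mathsf{P}_{\mathcal{Q}}f=f_!$, $(f_!\sigma)_y=\bigvee_{x\in f^{-1}y}\sigma_x$; $(\mathsf{y}_Xy)_x=1_{|y|}$ if $x=y$, else $\bot$; $(\mathsf{s}_X\Sigma)_x=\bigvee_{\sigma}\Sigma_\sigma\circ\sigma_x$. For $\varphi\colon X\nrightarrow Y$, $\overleftarrow{\varphi}\colon Y\to\mathsf{P}_{\mathcal{Q}}X$ is $(\overleftarrow{\varphi}(y))_x=\varphi(x,y)$; $\varepsilon_X\colon X\nrightarrow\mathsf{P}_{\mathcal{Q}}X$ is $\varepsilon_X(x,\sigma)=\sigma_x$. The lift of $\mathbb{T}$ to $\mathbf{Set}/\mathcal{Q}_0$ via $\zeta$ gives $TX$ the array map $\zeta\cdot Ta$ when $X$ has array map $a$; likewise for $\mathcal{R}$ and $\eta$. $B_{\vartheta_0}\colon\mathbf{Set}/\mathcal{Q}_0\to\mathbf{Set}/\mathcal{R}_0$ sends $(X,a)$ to $(X,\vartheta_0\cdot a)$ and commutes with the lifted monads: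 $B_{\vartheta_0}T=TB_{\vartheta_0}$, etc. For $\varphi\colon X\nrightarrow Y$ in $\mathcal{Q}\text{-}\mathbf{Rel}$, $\tilde{B}_\vartheta\varphi\colon B_{\vartheta_0}X\nrightarrow B_{\vartheta_0}Y$ is $(\tilde{B}_\vartheta\varphi)(x,y)=\vartheta(\varphi(x,y))$. The map $\vartheta_X\colon B_{\vartheta_0}\mathsf{P}_{\mathcal{Q}}X\to\mathsf{P}_{\mathcal{R}}B_{\vartheta_0}X$ is $(\sigma_x)_{x}\mapsto(\vartheta(\sigma_x))_{x}$. Below, $\mathsf{P}=\mathsf{P}_{\mathcal{Q}}$. A monotone distributive law of $\mathbb{T}$ over $\mathbb{P}_{\mathcal{Q}}$ is a family of morphisms $\lambda_X\colon T\mathsf{P}X\to\mathsf{P}TX$ in $\mathbf{Set}/\mathcal{Q}_0$ such that for all $X$ and $f\colon X\to Y$: $(Tf)_!\cdot\lambda_X\le\lambda_Y\cdot T(f_!)$; $\mathsf{y}_{TX}\le\lambda_X\cdot T\mathsf{y}_X$; $\mathsf{s}_{TX}\cdot(\lambda_X)_!\cdot\lambda_{\mathsf{P}X}\le\lambda_X\cdot T\mathsf{s}_X$; $(e_X)_!\le\lambda_X\cdot e_{\mathsf{P}X}$; $(m_X)_!\cdot\lambda_{TX}\cdot T\lambda_X\le\lambda_X\cdot m_{\mathsf{P}X}$; and $f\le g\Rightarrow\lambda_X\cdot Tf\le\lambda_X\cdot Tg$ for all $f,g\colon Y\to\mathsf{P}X$. A lax extension $\hat{T}$ of $\mathbb{T}$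 to $\mathcal{Q}\text{-}\mathbf{Rel}$ is a family of $\mathcal{Q}$-relations $\hat{T}\varphi\colon TX\nrightarrow TY$ $(\varphi\colon X\nrightarrow Y)$, monotone in $\varphi$, with $\hat{T}(h^\circ\circ\varphi)=(Th)^\circ\circ\hat{T}\varphi$ ($h\colon Z\to Y$), $1_{TX}^\circ\le\hat{T}(1_X^\circ)$, $\hat{T}\psi\circ\hat{T}\varphi\le\hat{T}(\psi\circ\varphi)$, $\varphi\circ e_X^\circ\le e_Y^\circ\circ\hat{T}\varphi$, $\hat{T}\hat{T}\varphi\circ m_X^\circ\le m_Y^\circ\circ\hat{T}\varphi$. These correspond bijectively via $\overleftarrow{\hat{T}\varphi}=\lambda_X\cdot T\overleftarrow{\varphi}$, $\lambda_X=\overleftarrow{\hat{T}\varepsilon_X}$. $(\lambda,\mathcal{Q})\text{-}\mathbf{Alg}$: objects $(X,p)$ with $p\colon TX\to\mathsf{P}X$ in $\mathbf{Set}/\mathcal{Q}_0$, $\mathsf{y}_X\le p\cdot e_X$, $\mathsf{s}_X\cdot p_!\cdot\lambda_X\cdot Tp\le p\cdot m_X$; morphisms $f\colon(X,p)\to(Y,q)$ in $\mathbf{Set}/\mathcal{Q}_0$ with $f_!\cdot p\le q\cdot Tf$. $(\mathbb{T},\hat{T},\mathcal{Q})\text{-}\mathbf{Cat}$: objects $(X,\alpha)$ with $\alpha\colon X\nrightarrow TX$, $1_X^\circ\le e_X^\circ\circ\alpha$, $\hat{T}\alpha\circ\alpha\le m_X^\circ\circ\alpha$; morphisms $f\colon(X,\alpha)\to(Y,\beta)$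 in $\mathbf{Set}/\mathcal{Q}_0$ with $\alpha\circ f^\circ\le(Tf)^\circ\circ\beta$. These two categories are isomorphic via $(X,\alpha)\mapsto(X,\overleftarrow{\alpha})$; "equivalently described" refers to these isomorphisms. All functors leave underlying maps of morphisms unchanged. The same definitions apply to $\mathcal{R},\check{T},\kappa$. *)

theory Defs
  imports "HOL-Algebra.Complete_Lattice" "HOL-Library.FuncSet" "HOL-Library.Nat_Bijection"
begin

section \<open>The category of sets\<close>

text \<open>
  A monad on the category of sets has to be applied to carriers such as \<open>X\<close>, \<open>PX\<close>, \<open>TPX\<close>, \<open>PPX\<close>
  alike, so all sets live in one universe. A type of the following class is a Grothendieck universe:
  every element is (a code of) a set of elements, and the sets that have a code are closed under
  subsets, pairs, power sets and unions of families (hence under replacement). "Set" means a set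
  that has a code. The axiom of infinity is not needed and therefore not assumed; universes of
  ZFC sets are included, and so are the hereditarily finite sets (see the instance below, which
  also shows that the axioms are consistent).
\<close>

class grothendieck_universe =
  fixes elts :: "'a \<Rightarrow> 'a set"
  assumes elts_inject: "elts x = elts y \<Longrightarrow> x = y"
    and elts_subset: "A \<subseteq> elts x \<Longrightarrow> A \<in> range elts"
    and elts_pair: "{x, y} \<in> range elts"
    and elts_Pow: "{y. elts y \<subseteq> elts x} \<in> range elts"
    and elts_UN: "(\<Union>y\<in>elts x. elts (f y)) \<in> range elts"

instantiation nat :: grothendieck_universe
begin

definition elts_nat :: "nat \<Rightarrow> nat set" where "elts_nat = set_decode"

instance
proof
  have ran: "A \<in> range (elts :: nat \<Rightarrow> nat set)" if "finite A" for A
    using that by (metis elts_nat_def rangeI set_encode_inverse)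
  have fin: "finite (elts x)" for x :: nat
    by (simp add: elts_nat_def)
  fix x y :: nat and A :: "nat set" and f :: "nat \<Rightarrow> nat"
  show "x = y" if "elts x = elts y"
    using that by (metis elts_nat_def set_decode_inverse)
  show "A \<in> range elts" if "A \<subseteq> elts x"
    using that fin ran finite_subset by metis
  show "{x, y} \<in> range elts"
    by (rule ran) simp
  have "{y. elts y \<subseteq> elts x} \<subseteq> set_encode ` Pow (elts x)"
    by (auto simp: elts_nat_def) (metis Pow_iff image_eqI set_decode_inverse)
  then show "{y. elts y \<subseteq> elts x} \<in> range elts"
    by (intro ran) (meson fin finite_Pow_iff finite_imageI finite_subset)
  show "(\<Union>y\<in>elts x. elts (f y)) \<in> range elts"
    by (rule ran) (simp add: fin)
qed

end

definition small :: "'v::grothendieck_universe set \<Rightarrow> bool" where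
  "small A \<longleftrightarrow> A \<in> range elts"

text \<open>The code of a small set, and Kuratowski pairs of elements of the universe.\<close>

definition vset :: "'v::grothendieck_universe set \<Rightarrow> 'v" where
  "vset A = (THE x. elts x = A)"

definition vpair :: "'v::grothendieck_universe \<Rightarrow> 'v \<Rightarrow> 'v" where
  "vpair x y = vset {vset {x}, vset {x, y}}"

section \<open>Categories and functors\<close>

record ('o, 'm) cat =
  Obj :: "'o set"
  Mor :: "'o \<Rightarrow> 'o \<Rightarrow> 'm set"
  Idt :: "'o \<Rightarrow> 'm"
  Cps :: "'o \<Rightarrow> 'o \<Rightarrow> 'o \<Rightarrow> 'm \<Rightarrow> 'm \<Rightarrow> 'm"  \<comment> \<open>\<open>Cps C X Y Z g f\<close> is \<open>g \<cdot> f : X \<rightarrow> Y \<rightarrow> Z\<close>\<close>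

definition is_category :: "('o, 'm) cat \<Rightarrow> bool" where
  "is_category C \<longleftrightarrow>
     (\<forall>X\<in>Obj C. Idt C X \<in> Mor C X X) \<and>
     (\<forall>X\<in>Obj C. \<forall>Y\<in>Obj C. \<forall>Z\<in>Obj C. \<forall>f\<in>Mor C X Y. \<forall>g\<in>Mor C Y Z. Cps C X Y Z g f \<in> Mor C X Z) \<and>
     (\<forall>X\<in>Obj C. \<forall>Y\<in>Obj C. \<forall>f\<in>Mor C X Y. Cps C X X Y f (Idt C X) = f \<and> Cps C X Y Y (Idt C Y) f = f) \<and>
     (\<forall>W\<in>Obj C. \<forall>X\<in>Obj C. \<forall>Y\<in>Obj C. \<forall>Z\<in>Obj C.
        \<forall>f\<in>Mor C W X. \<forall>g\<in>Mor C X Y. \<forall>h\<in>Mor C Y Z.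
          Cps C W X Z (Cps C X Y Z h g) f = Cps C W Y Z h (Cps C W X Y g f))"

definition is_functor ::
  "('o, 'm) cat \<Rightarrow> ('p, 'n) cat \<Rightarrow> ('o \<Rightarrow> 'p) \<Rightarrow> ('o \<Rightarrow> 'o \<Rightarrow> 'm \<Rightarrow> 'n) \<Rightarrow> bool" where
  "is_functor C D Fo Fm \<longleftrightarrow>
     is_category C \<and> is_category D \<and>
     (\<forall>X\<in>Obj C. Fo X \<in> Obj D) \<and>
     (\<forall>X\<in>Obj C. \<forall>Y\<in>Obj C. \<forall>f\<in>Mor C X Y. Fm X Y f \<in> Mor D (Fo X) (Fo Y)) \<and>
     (\<forall>X\<in>Obj C. Fm X X (Idt C X) = Idt D (Fo X)) \<and>
     (\<forall>X\<in>Obj C. \<forall>Y\<in>Obj C. \<forall>Z\<in>Obj C. \<forall>f\<in>Mor C X Y. \<forall>g\<in>Mor C Y Z.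
        Fm X Z (Cps C X Y Z g f) = Cps D (Fo X) (Fo Y) (Fo Z) (Fm Y Z g) (Fm X Y f))"

definition is_cat_isomorphism ::
  "('o, 'm) cat \<Rightarrow> ('p, 'n) cat \<Rightarrow> ('o \<Rightarrow> 'p) \<Rightarrow> ('o \<Rightarrow> 'o \<Rightarrow> 'm \<Rightarrow> 'n) \<Rightarrow> bool" where
  "is_cat_isomorphism C D Fo Fm \<longleftrightarrow>
     is_functor C D Fo Fm \<and> bij_betw Fo (Obj C) (Obj D) \<and>
     (\<forall>X\<in>Obj C. \<forall>Y\<in>Obj C. bij_betw (Fm X Y) (Mor C X Y) (Mor D (Fo X) (Fo Y)))"

definition set_cat :: "('v::grothendieck_universe set, 'v \<Rightarrow> 'v) cat" where
  "set_cat = \<lparr>Obj = {X. small X}, Mor = (\<lambda>X Y. X \<rightarrow>\<^sub>E Y), Idt = (\<lambda>X. \<lambda>x\<in>X. x),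
     Cps = (\<lambda>X Y Z g f. compose X g f)\<rparr>"

section \<open>Monads on the category of sets\<close>

record 'v monad =
  TOb :: "'v set \<Rightarrow> 'v set"
  TMap :: "'v set \<Rightarrow> 'v set \<Rightarrow> ('v \<Rightarrow> 'v) \<Rightarrow> 'v \<Rightarrow> 'v"
  mmult :: "'v set \<Rightarrow> 'v \<Rightarrow> 'v"
  munit :: "'v set \<Rightarrow> 'v \<Rightarrow> 'v"

definition set_monad :: "'v::grothendieck_universe monad \<Rightarrow> bool" where
  "set_monad T \<longleftrightarrow>
     is_functor set_cat set_cat (TOb T) (TMap T) \<and>
     (\<forall>X. small X \<longrightarrow> munit T X \<in> X \<rightarrow>\<^sub>E TOb T X) \<and>
     (\<forall>X. small X \<longrightarrow> mmult T X \<in> TOb T (TOb T X) \<rightarrow>\<^sub>E TOb T X) \<and>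
     (\<forall>X Y. small X \<and> small Y \<longrightarrow> (\<forall>f\<in>X \<rightarrow>\<^sub>E Y.
        compose X (TMap T X Y f) (munit T X) = compose X (munit T Y) f)) \<and>
     (\<forall>X Y. small X \<and> small Y \<longrightarrow> (\<forall>f\<in>X \<rightarrow>\<^sub>E Y.
        compose (TOb T (TOb T X)) (TMap T X Y f) (mmult T X) =
        compose (TOb T (TOb T X)) (mmult T Y) (TMap T (TOb T X) (TOb T Y) (TMap T X Y f)))) \<and>
     (\<forall>X. small X \<longrightarrow>
        compose (TOb T X) (mmult T X) (munit T (TOb T X)) = (\<lambda>t\<in>TOb T X. t) \<and>
        compose (TOb T X) (mmult T X) (TMap T X (TOb T X) (munit T X)) = (\<lambda>t\<in>TOb T X. t) \<and>
        compose (TOb T (TOb T (TOb T X))) (mmult T X) (mmult T (TOb T X)) =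
        compose (TOb T (TOb T (TOb T X))) (mmult T X) (TMap T (TOb T (TOb T X)) (TOb T X) (mmult T X)))"

definition monad_algebra :: "'v::grothendieck_universe monad \<Rightarrow> 'v set \<Rightarrow> ('v \<Rightarrow> 'v) \<Rightarrow> bool" where
  "monad_algebra T A \<zeta> \<longleftrightarrow>
     small A \<and> \<zeta> \<in> TOb T A \<rightarrow>\<^sub>E A \<and>
     compose A \<zeta> (munit T A) = (\<lambda>a\<in>A. a) \<and>
     compose (TOb T (TOb T A)) \<zeta> (TMap T (TOb T A) A \<zeta>) = compose (TOb T (TOb T A)) \<zeta> (mmult T A)"

definition monad_hom ::
  "'v::grothendieck_universe monad \<Rightarrow> 'v set \<Rightarrow> ('v \<Rightarrow> 'v) \<Rightarrow> 'v set \<Rightarrow> ('v \<Rightarrow> 'v) \<Rightarrow> ('v \<Rightarrow> 'v) \<Rightarrow> bool" where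
  "monad_hom T A \<zeta> B \<eta> h \<longleftrightarrow>
     h \<in> A \<rightarrow>\<^sub>E B \<and> compose (TOb T A) h \<zeta> = compose (TOb T A) \<eta> (TMap T A B h)"

section \<open>Small quantaloids and lax homomorphisms\<close>

text \<open>
  \<open>Comp Q r s t v u\<close> is \<open>v \<circ> u\<close> for \<open>u : r \<rightarrow> s\<close> and \<open>v : s \<rightarrow> t\<close>. Hom-sets need not be disjoint,
  so all operations carry their objects as arguments.
\<close>

record 'v quantaloid =
  Ob :: "'v set"
  Hom :: "'v \<Rightarrow> 'v \<Rightarrow> 'v gorder"
  One :: "'v \<Rightarrow> 'v"
  Comp :: "'v \<Rightarrow> 'v \<Rightarrow> 'v \<Rightarrow> 'v \<Rightarrow> 'v \<Rightarrow> 'v"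

abbreviation qle :: "'v quantaloid \<Rightarrow> 'v \<Rightarrow> 'v \<Rightarrow> 'v \<Rightarrow> 'v \<Rightarrow> bool" where
  "qle Q s t u v \<equiv> u \<sqsubseteq>\<^bsub>Hom Q s t\<^esub> v"

abbreviation qsup :: "'v quantaloid \<Rightarrow> 'v \<Rightarrow> 'v \<Rightarrow> 'v set \<Rightarrow> 'v" where
  "qsup Q s t A \<equiv> \<Squnion>\<^bsub>Hom Q s t\<^esub>A"

abbreviation qbot :: "'v quantaloid \<Rightarrow> 'v \<Rightarrow> 'v \<Rightarrow> 'v" where
  "qbot Q s t \<equiv> \<bottom>\<^bsub>Hom Q s t\<^esub>"

definition small_quantaloid :: "'v::grothendieck_universe quantaloid \<Rightarrow> bool" where
  "small_quantaloid Q \<longleftrightarrow>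
     small (Ob Q) \<and>
     (\<forall>s\<in>Ob Q. \<forall>t\<in>Ob Q. small (carrier (Hom Q s t)) \<and> complete_lattice (Hom Q s t)) \<and>
     (\<forall>s\<in>Ob Q. One Q s \<in> carrier (Hom Q s s)) \<and>
     (\<forall>r\<in>Ob Q. \<forall>s\<in>Ob Q. \<forall>t\<in>Ob Q. \<forall>u\<in>carrier (Hom Q r s). \<forall>v\<in>carrier (Hom Q s t).
        Comp Q r s t v u \<in> carrier (Hom Q r t)) \<and>
     (\<forall>s\<in>Ob Q. \<forall>t\<in>Ob Q. \<forall>u\<in>carrier (Hom Q s t).
        Comp Q s s t u (One Q s) = u \<and> Comp Q s t t (One Q t) u = u) \<and>
     (\<forall>q\<in>Ob Q. \<forall>r\<in>Ob Q. \<forall>s\<in>Ob Q. \<forall>t\<in>Ob Q.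
        \<forall>u\<in>carrier (Hom Q q r). \<forall>v\<in>carrier (Hom Q r s). \<forall>w\<in>carrier (Hom Q s t).
          Comp Q q r t (Comp Q r s t w v) u = Comp Q q s t w (Comp Q q r s v u)) \<and>
     (\<forall>r\<in>Ob Q. \<forall>s\<in>Ob Q. \<forall>t\<in>Ob Q. \<forall>A. \<forall>v\<in>carrier (Hom Q s t). A \<subseteq> carrier (Hom Q r s) \<longrightarrow>
        Comp Q r s t v (qsup Q r s A) = qsup Q r t ((\<lambda>u. Comp Q r s t v u) ` A)) \<and>
     (\<forall>r\<in>Ob Q. \<forall>s\<in>Ob Q. \<forall>t\<in>Ob Q. \<forall>A. \<forall>u\<in>carrier (Hom Q r s). A \<subseteq> carrier (Hom Q s t) \<longrightarrow>
        Comp Q r s t (qsup Q s t A) u = qsup Q r t ((\<lambda>v. Comp Q r s t v u) ` A))"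

definition lax_hom ::
  "'v::grothendieck_universe quantaloid \<Rightarrow> 'v quantaloid \<Rightarrow> ('v \<Rightarrow> 'v) \<Rightarrow> ('v \<Rightarrow> 'v \<Rightarrow> 'v \<Rightarrow> 'v) \<Rightarrow> bool" where
  "lax_hom Q R \<theta>\<^sub>0 \<theta> \<longleftrightarrow>
     \<theta>\<^sub>0 \<in> Ob Q \<rightarrow>\<^sub>E Ob R \<and>
     (\<forall>s\<in>Ob Q. \<forall>t\<in>Ob Q.
        \<theta> s t \<in> carrier (Hom Q s t) \<rightarrow> carrier (Hom R (\<theta>\<^sub>0 s) (\<theta>\<^sub>0 t)) \<and>
        isotone (Hom Q s t) (Hom R (\<theta>\<^sub>0 s) (\<theta>\<^sub>0 t)) (\<theta> s t)) \<and>
     (\<forall>t\<in>Ob Q. qle R (\<theta>\<^sub>0 t) (\<theta>\<^sub>0 t) (One R (\<theta>\<^sub>0 t)) (\<theta> t t (One Q t))) \<and>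
     (\<forall>r\<in>Ob Q. \<forall>s\<in>Ob Q. \<forall>t\<in>Ob Q. \<forall>u\<in>carrier (Hom Q r s). \<forall>v\<in>carrier (Hom Q s t).
        qle R (\<theta>\<^sub>0 r) (\<theta>\<^sub>0 t)
          (Comp R (\<theta>\<^sub>0 r) (\<theta>\<^sub>0 s) (\<theta>\<^sub>0 t) (\<theta> s t v) (\<theta> r s u)) (\<theta> r t (Comp Q r s t v u)))"

section \<open>Sets over the object set, and the lifted monad\<close>

text \<open>An object of the slice is a set with its array map. Maps are extensional functions.\<close>

type_synonym 'v ob = "'v set \<times> ('v \<Rightarrow> 'v)"

abbreviation und :: "'v ob \<Rightarrow> 'v set" where "und X \<equiv> fst X"
abbreviation arr :: "'v ob \<Rightarrow> 'v \<Rightarrow> 'v" where "arr X \<equiv> snd X"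

definition slice_ob :: "'v::grothendieck_universe quantaloid \<Rightarrow> 'v ob set" where
  "slice_ob Q = {X. small (und X) \<and> arr X \<in> und X \<rightarrow>\<^sub>E Ob Q}"

definition slice_hom :: "'v ob \<Rightarrow> 'v ob \<Rightarrow> ('v \<Rightarrow> 'v) set" where
  "slice_hom X Y = {f \<in> und X \<rightarrow>\<^sub>E und Y. \<forall>x\<in>und X. arr Y (f x) = arr X x}"

definition lift_ob :: "'v monad \<Rightarrow> 'v quantaloid \<Rightarrow> ('v \<Rightarrow> 'v) \<Rightarrow> 'v ob \<Rightarrow> 'v ob" where
  "lift_ob T Q \<zeta> X =
     (TOb T (und X), compose (TOb T (und X)) \<zeta> (TMap T (und X) (Ob Q) (arr X)))"

abbreviation Tm :: "'v monad \<Rightarrow> 'v ob \<Rightarrow> 'v ob \<Rightarrow> ('v \<Rightarrow> 'v) \<Rightarrow> 'v \<Rightarrow> 'v" where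
  "Tm T X Y f \<equiv> TMap T (und X) (und Y) f"

section \<open>Relations valued in a quantaloid\<close>

type_synonym 'v qrel = "'v \<Rightarrow> 'v \<Rightarrow> 'v"

definition qrels :: "'v quantaloid \<Rightarrow> 'v ob \<Rightarrow> 'v ob \<Rightarrow> 'v qrel set" where
  "qrels Q X Y = (\<Pi>\<^sub>E x\<in>und X. \<Pi>\<^sub>E y\<in>und Y. carrier (Hom Q (arr X x) (arr Y y)))"

definition qrel_le :: "'v quantaloid \<Rightarrow> 'v ob \<Rightarrow> 'v ob \<Rightarrow> 'v qrel \<Rightarrow> 'v qrel \<Rightarrow> bool" where
  "qrel_le Q X Y \<phi> \<psi> \<longleftrightarrow> (\<forall>x\<in>und X. \<forall>y\<in>und Y. qle Q (arr X x) (arr Y y) (\<phi> x y) (\<psi> x y))"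

definition qrel_comp ::
  "'v quantaloid \<Rightarrow> 'v ob \<Rightarrow> 'v ob \<Rightarrow> 'v ob \<Rightarrow> 'v qrel \<Rightarrow> 'v qrel \<Rightarrow> 'v qrel" where
  "qrel_comp Q X Y Z \<psi> \<phi> =
     (\<lambda>x\<in>und X. \<lambda>z\<in>und Z. qsup Q (arr X x) (arr Z z)
        ((\<lambda>y. Comp Q (arr X x) (arr Y y) (arr Z z) (\<psi> y z) (\<phi> x y)) ` und Y))"

text \<open>\<open>cograph Q X Y f\<close> is \<open>f\<^sup>\<circ> : Y \<rightarrow> X\<close> for \<open>f : X \<rightarrow> Y\<close>.\<close>

definition cograph :: "'v quantaloid \<Rightarrow> 'v ob \<Rightarrow> 'v ob \<Rightarrow> ('v \<Rightarrow> 'v) \<Rightarrow> 'v qrel" where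
  "cograph Q X Y f =
     (\<lambda>y\<in>und Y. \<lambda>x\<in>und X. if f x = y then One Q (arr X x) else qbot Q (arr Y y) (arr X x))"

definition qrel_id :: "'v quantaloid \<Rightarrow> 'v ob \<Rightarrow> 'v qrel" where
  "qrel_id Q X = cograph Q X X (\<lambda>x\<in>und X. x)"

section \<open>The discrete presheaf monad\<close>

text \<open>
  A presheaf \<open>(\<sigma>\<^sub>x : \<bar>x\<bar> \<rightarrow> s)\<close> is coded by the element of the universe that is the pair of \<open>s\<close>
  and the graph of \<open>\<sigma>\<close>; \<open>psh_arr\<close> and \<open>psh_val\<close> recover \<open>s\<close> and \<open>\<sigma>\<^sub>x\<close> from the code.
\<close>

definition psh_code :: "'v::grothendieck_universe set \<Rightarrow> 'v \<Rightarrow> ('v \<Rightarrow> 'v) \<Rightarrow> 'v" where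
  "psh_code X s \<sigma> = vpair s (vset ((\<lambda>x. vpair x (\<sigma> x)) ` X))"

definition psh_arr :: "'v::grothendieck_universe \<Rightarrow> 'v" where
  "psh_arr p = (THE s. \<exists>w. p = vpair s w)"

definition psh_val :: "'v::grothendieck_universe \<Rightarrow> 'v \<Rightarrow> 'v" where
  "psh_val p x = (THE u. \<exists>s w. p = vpair s w \<and> vpair x u \<in> elts w)"

definition psh_set :: "'v::grothendieck_universe quantaloid \<Rightarrow> 'v ob \<Rightarrow> 'v set" where
  "psh_set Q X = {psh_code (und X) s \<sigma> | s \<sigma>.
     s \<in> Ob Q \<and> \<sigma> \<in> (\<Pi>\<^sub>E x\<in>und X. carrier (Hom Q (arr X x) s))}"

definition psh :: "'v::grothendieck_universe quantaloid \<Rightarrow> 'v ob \<Rightarrow> 'v ob" where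
  "psh Q X = (psh_set Q X, \<lambda>p\<in>psh_set Q X. psh_arr p)"

text \<open>The pointwise order of maps \<open>f, g\<close> from a set \<open>Z\<close> into the presheaves on \<open>X\<close>.\<close>

definition psh_le ::
  "'v::grothendieck_universe quantaloid \<Rightarrow> 'v ob \<Rightarrow> 'v set \<Rightarrow> ('v \<Rightarrow> 'v) \<Rightarrow> ('v \<Rightarrow> 'v) \<Rightarrow> bool" where
  "psh_le Q X Z f g \<longleftrightarrow>
     (\<forall>z\<in>Z. psh_arr (f z) = psh_arr (g z) \<and>
        (\<forall>x\<in>und X. qle Q (arr X x) (psh_arr (f z)) (psh_val (f z) x) (psh_val (g z) x)))"

text \<open>\<open>f\<^sub>!\<close>\<close>

definition psh_map ::
  "'v::grothendieck_universe quantaloid \<Rightarrow> 'v ob \<Rightarrow> 'v ob \<Rightarrow> ('v \<Rightarrow> 'v) \<Rightarrow> 'v \<Rightarrow> 'v" where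
  "psh_map Q X Y f =
     (\<lambda>p\<in>psh_set Q X. psh_code (und Y) (psh_arr p)
        (\<lambda>y\<in>und Y. qsup Q (arr Y y) (psh_arr p) (psh_val p ` {x \<in> und X. f x = y})))"

text \<open>The unit \<open>y\<close> and the multiplication \<open>s\<close>\<close>

definition psh_unit :: "'v::grothendieck_universe quantaloid \<Rightarrow> 'v ob \<Rightarrow> 'v \<Rightarrow> 'v" where
  "psh_unit Q X =
     (\<lambda>y\<in>und X. psh_code (und X) (arr X y)
        (\<lambda>x\<in>und X. if x = y then One Q (arr X y) else qbot Q (arr X x) (arr X y)))"

definition psh_mult :: "'v::grothendieck_universe quantaloid \<Rightarrow> 'v ob \<Rightarrow> 'v \<Rightarrow> 'v" where
  "psh_mult Q X =
     (\<lambda>S\<in>psh_set Q (psh Q X). psh_code (und X) (psh_arr S)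
        (\<lambda>x\<in>und X. qsup Q (arr X x) (psh_arr S)
           ((\<lambda>p. Comp Q (arr X x) (psh_arr p) (psh_arr S) (psh_val S p) (psh_val p x)) ` psh_set Q X)))"

text \<open>The map \<open>Y \<rightarrow> PX\<close> of a relation \<open>\<phi>\<close> from \<open>X\<close> to \<open>Y\<close>, and the evaluation relation from
  \<open>X\<close> to \<open>PX\<close>.\<close>

definition psh_of_rel ::
  "'v::grothendieck_universe ob \<Rightarrow> 'v ob \<Rightarrow> 'v qrel \<Rightarrow> 'v \<Rightarrow> 'v" where
  "psh_of_rel X Y \<phi> = (\<lambda>y\<in>und Y. psh_code (und X) (arr Y y) (\<lambda>x\<in>und X. \<phi> x y))"

definition eval_rel :: "'v::grothendieck_universe quantaloid \<Rightarrow> 'v ob \<Rightarrow> 'v qrel" where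
  "eval_rel Q X = (\<lambda>x\<in>und X. \<lambda>p\<in>psh_set Q X. psh_val p x)"

section \<open>Monotone distributive laws and lax extensions\<close>

definition monotone_distributive_law ::
  "'v::grothendieck_universe monad \<Rightarrow> 'v quantaloid \<Rightarrow> ('v \<Rightarrow> 'v) \<Rightarrow> ('v ob \<Rightarrow> 'v \<Rightarrow> 'v) \<Rightarrow> bool" where
  "monotone_distributive_law T Q \<zeta> \<Lambda> \<longleftrightarrow>
    (let L = lift_ob T Q \<zeta>; P = psh Q in
     (\<forall>X\<in>slice_ob Q. \<Lambda> X \<in> slice_hom (L (P X)) (P (L X))) \<and>
     (\<forall>X\<in>slice_ob Q. \<forall>Y\<in>slice_ob Q. \<forall>f\<in>slice_hom X Y.
        psh_le Q (L Y) (und (L (P X)))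
          (compose (und (L (P X))) (psh_map Q (L X) (L Y) (Tm T X Y f)) (\<Lambda> X))
          (compose (und (L (P X))) (\<Lambda> Y) (Tm T (P X) (P Y) (psh_map Q X Y f)))) \<and>
     (\<forall>X\<in>slice_ob Q.
        psh_le Q (L X) (und (L X))
          (psh_unit Q (L X))
          (compose (und (L X)) (\<Lambda> X) (Tm T X (P X) (psh_unit Q X)))) \<and>
     (\<forall>X\<in>slice_ob Q.
        psh_le Q (L X) (und (L (P (P X))))
          (compose (und (L (P (P X)))) (psh_mult Q (L X))
            (compose (und (L (P (P X)))) (psh_map Q (L (P X)) (P (L X)) (\<Lambda> X)) (\<Lambda> (P X))))
          (compose (und (L (P (P X)))) (\<Lambda> X) (Tm T (P (P X)) (P X) (psh_mult Q X)))) \<and>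
     (\<forall>X\<in>slice_ob Q.
        psh_le Q (L X) (und (P X))
          (psh_map Q X (L X) (munit T (und X)))
          (compose (und (P X)) (\<Lambda> X) (munit T (und (P X))))) \<and>
     (\<forall>X\<in>slice_ob Q.
        psh_le Q (L X) (und (L (L (P X))))
          (compose (und (L (L (P X)))) (psh_map Q (L (L X)) (L X) (mmult T (und X)))
            (compose (und (L (L (P X)))) (\<Lambda> (L X)) (Tm T (L (P X)) (P (L X)) (\<Lambda> X))))
          (compose (und (L (L (P X)))) (\<Lambda> X) (mmult T (und (P X))))) \<and>
     (\<forall>X\<in>slice_ob Q. \<forall>Y\<in>slice_ob Q. \<forall>f\<in>slice_hom Y (P X). \<forall>g\<in>slice_hom Y (P X).
        psh_le Q X (und Y) f g \<longrightarrow>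
        psh_le Q (L X) (und (L Y))
          (compose (und (L Y)) (\<Lambda> X) (Tm T Y (P X) f))
          (compose (und (L Y)) (\<Lambda> X) (Tm T Y (P X) g))))"

text \<open>A lax extension \<open>E\<close> sends \<open>\<phi>\<close> in \<open>qrels Q X Y\<close> to \<open>E X Y \<phi>\<close>.\<close>

definition lax_extension ::
  "'v::grothendieck_universe monad \<Rightarrow> 'v quantaloid \<Rightarrow> ('v \<Rightarrow> 'v) \<Rightarrow>
   ('v ob \<Rightarrow> 'v ob \<Rightarrow> 'v qrel \<Rightarrow> 'v qrel) \<Rightarrow> bool" where
  "lax_extension T Q \<zeta> E \<longleftrightarrow>
    (let L = lift_ob T Q \<zeta> in
     (\<forall>X\<in>slice_ob Q. \<forall>Y\<in>slice_ob Q. \<forall>\<phi>\<in>qrels Q X Y. E X Y \<phi> \<in> qrels Q (L X) (L Y)) \<and>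
     (\<forall>X\<in>slice_ob Q. \<forall>Y\<in>slice_ob Q. \<forall>\<phi>\<in>qrels Q X Y. \<forall>\<psi>\<in>qrels Q X Y.
        qrel_le Q X Y \<phi> \<psi> \<longrightarrow> qrel_le Q (L X) (L Y) (E X Y \<phi>) (E X Y \<psi>)) \<and>
     (\<forall>X\<in>slice_ob Q. \<forall>Y\<in>slice_ob Q. \<forall>Z\<in>slice_ob Q. \<forall>\<phi>\<in>qrels Q X Y. \<forall>h\<in>slice_hom Z Y.
        E X Z (qrel_comp Q X Y Z (cograph Q Z Y h) \<phi>) =
        qrel_comp Q (L X) (L Y) (L Z) (cograph Q (L Z) (L Y) (Tm T Z Y h)) (E X Y \<phi>)) \<and>
     (\<forall>X\<in>slice_ob Q. qrel_le Q (L X) (L X) (qrel_id Q (L X)) (E X X (qrel_id Q X))) \<and>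
     (\<forall>X\<in>slice_ob Q. \<forall>Y\<in>slice_ob Q. \<forall>Z\<in>slice_ob Q. \<forall>\<phi>\<in>qrels Q X Y. \<forall>\<psi>\<in>qrels Q Y Z.
        qrel_le Q (L X) (L Z)
          (qrel_comp Q (L X) (L Y) (L Z) (E Y Z \<psi>) (E X Y \<phi>))
          (E X Z (qrel_comp Q X Y Z \<psi> \<phi>))) \<and>
     (\<forall>X\<in>slice_ob Q. \<forall>Y\<in>slice_ob Q. \<forall>\<phi>\<in>qrels Q X Y.
        qrel_le Q (L X) Y
          (qrel_comp Q (L X) X Y \<phi> (cograph Q X (L X) (munit T (und X))))
          (qrel_comp Q (L X) (L Y) Y (cograph Q Y (L Y) (munit T (und Y))) (E X Y \<phi>))) \<and>
     (\<forall>X\<in>slice_ob Q. \<forall>Y\<in>slice_ob Q. \<forall>\<phi>\<in>qrels Q X Y.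
        qrel_le Q (L X) (L (L Y))
          (qrel_comp Q (L X) (L (L X)) (L (L Y))
            (E (L X) (L Y) (E X Y \<phi>)) (cograph Q (L (L X)) (L X) (mmult T (und X))))
          (qrel_comp Q (L X) (L Y) (L (L Y))
            (cograph Q (L (L Y)) (L Y) (mmult T (und Y))) (E X Y \<phi>))))"

text \<open>The two mutually inverse assignments between lax extensions and monotone distributive laws.\<close>

definition law_extension_correspond ::
  "'v::grothendieck_universe monad \<Rightarrow> 'v quantaloid \<Rightarrow> ('v \<Rightarrow> 'v) \<Rightarrow>
   ('v ob \<Rightarrow> 'v ob \<Rightarrow> 'v qrel \<Rightarrow> 'v qrel) \<Rightarrow> ('v ob \<Rightarrow> 'v \<Rightarrow> 'v) \<Rightarrow> bool" where
  "law_extension_correspond T Q \<zeta> E \<Lambda> \<longleftrightarrow>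
    (let L = lift_ob T Q \<zeta>; P = psh Q in
     (\<forall>X\<in>slice_ob Q. \<Lambda> X = psh_of_rel (L X) (L (P X)) (E X (P X) (eval_rel Q X))) \<and>
     (\<forall>X\<in>slice_ob Q. \<forall>Y\<in>slice_ob Q. \<forall>\<phi>\<in>qrels Q X Y.
        psh_of_rel (L X) (L Y) (E X Y \<phi>) =
        compose (und (L Y)) (\<Lambda> X) (Tm T Y (P X) (psh_of_rel X Y \<phi>))))"

section \<open>The categories of lax algebras\<close>

definition alg_cat ::
  "'v::grothendieck_universe monad \<Rightarrow> 'v quantaloid \<Rightarrow> ('v \<Rightarrow> 'v) \<Rightarrow> ('v ob \<Rightarrow> 'v \<Rightarrow> 'v) \<Rightarrow>
   ('v ob \<times> ('v \<Rightarrow> 'v), 'v \<Rightarrow> 'v) cat" where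
  "alg_cat T Q \<zeta> \<Lambda> =
    (let L = lift_ob T Q \<zeta>; P = psh Q in
     \<lparr>Obj = {(X, p). X \<in> slice_ob Q \<and> p \<in> slice_hom (L X) (P X) \<and>
         psh_le Q X (und X) (psh_unit Q X) (compose (und X) p (munit T (und X))) \<and>
         psh_le Q X (und (L (L X)))
           (compose (und (L (L X))) (psh_mult Q X)
             (compose (und (L (L X))) (psh_map Q (L X) (P X) p)
               (compose (und (L (L X))) (\<Lambda> X) (Tm T (L X) (P X) p))))
           (compose (und (L (L X))) p (mmult T (und X)))},
      Mor = (\<lambda>(X, p) (Y, q). {f \<in> slice_hom X Y.
         psh_le Q Y (und (L X))
           (compose (und (L X)) (psh_map Q X Y f) p)
           (compose (und (L X)) q (Tm T X Y f))}),
      Idt = (\<lambda>(X, p). \<lambda>x\<in>und X. x),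
      Cps = (\<lambda>(X, p) (Y, q) (Z, r) g f. compose (und X) g f)\<rparr>)"

definition tqcat ::
  "'v::grothendieck_universe monad \<Rightarrow> 'v quantaloid \<Rightarrow> ('v \<Rightarrow> 'v) \<Rightarrow>
   ('v ob \<Rightarrow> 'v ob \<Rightarrow> 'v qrel \<Rightarrow> 'v qrel) \<Rightarrow> ('v ob \<times> 'v qrel, 'v \<Rightarrow> 'v) cat" where
  "tqcat T Q \<zeta> E =
    (let L = lift_ob T Q \<zeta> in
     \<lparr>Obj = {(X, \<alpha>). X \<in> slice_ob Q \<and> \<alpha> \<in> qrels Q X (L X) \<and>
         qrel_le Q X X (qrel_id Q X)
           (qrel_comp Q X (L X) X (cograph Q X (L X) (munit T (und X))) \<alpha>) \<and>
         qrel_le Q X (L (L X))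
           (qrel_comp Q X (L X) (L (L X)) (E X (L X) \<alpha>) \<alpha>)
           (qrel_comp Q X (L X) (L (L X)) (cograph Q (L (L X)) (L X) (mmult T (und X))) \<alpha>)},
      Mor = (\<lambda>(X, \<alpha>) (Y, \<beta>). {f \<in> slice_hom X Y.
         qrel_le Q Y (L X)
           (qrel_comp Q Y X (L X) \<alpha> (cograph Q X Y f))
           (qrel_comp Q Y (L Y) (L X) (cograph Q (L X) (L Y) (Tm T X Y f)) \<beta>)}),
      Idt = (\<lambda>(X, \<alpha>). \<lambda>x\<in>und X. x),
      Cps = (\<lambda>(X, \<alpha>) (Y, \<beta>) (Z, \<gamma>) g f. compose (und X) g f)\<rparr>)"

definition cat_to_alg ::
  "'v::grothendieck_universe monad \<Rightarrow> 'v quantaloid \<Rightarrow> ('v \<Rightarrow> 'v) \<Rightarrow>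
   'v ob \<times> 'v qrel \<Rightarrow> 'v ob \<times> ('v \<Rightarrow> 'v)" where
  "cat_to_alg T Q \<zeta> = (\<lambda>(X, \<alpha>). (X, psh_of_rel X (lift_ob T Q \<zeta> X) \<alpha>))"

section \<open>Change of base\<close>

text \<open>On maps, the change of base along \<open>\<theta>\<^sub>0\<close> of sets over the object set is the identity.\<close>

definition base_ob :: "('v \<Rightarrow> 'v) \<Rightarrow> 'v ob \<Rightarrow> 'v ob" where
  "base_ob \<theta>\<^sub>0 X = (und X, compose (und X) \<theta>\<^sub>0 (arr X))"

definition base_rel :: "('v \<Rightarrow> 'v \<Rightarrow> 'v \<Rightarrow> 'v) \<Rightarrow> 'v ob \<Rightarrow> 'v ob \<Rightarrow> 'v qrel \<Rightarrow> 'v qrel" where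
  "base_rel \<theta> X Y \<phi> = (\<lambda>x\<in>und X. \<lambda>y\<in>und Y. \<theta> (arr X x) (arr Y y) (\<phi> x y))"

text \<open>The map \<open>\<theta>\<^sub>X\<close> from presheaves over \<open>Q\<close> to presheaves over \<open>R\<close>\<close>

definition base_psh ::
  "'v::grothendieck_universe quantaloid \<Rightarrow> ('v \<Rightarrow> 'v) \<Rightarrow> ('v \<Rightarrow> 'v \<Rightarrow> 'v \<Rightarrow> 'v) \<Rightarrow> 'v ob \<Rightarrow> 'v \<Rightarrow> 'v" where
  "base_psh Q \<theta>\<^sub>0 \<theta> X =
     (\<lambda>p\<in>psh_set Q X. psh_code (und X) (\<theta>\<^sub>0 (psh_arr p))
        (\<lambda>x\<in>und X. \<theta> (arr X x) (psh_arr p) (psh_val p x)))"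

definition base_cat ::
  "'v monad \<Rightarrow> 'v quantaloid \<Rightarrow> ('v \<Rightarrow> 'v) \<Rightarrow> ('v \<Rightarrow> 'v) \<Rightarrow> ('v \<Rightarrow> 'v \<Rightarrow> 'v \<Rightarrow> 'v) \<Rightarrow>
   'v ob \<times> 'v qrel \<Rightarrow> 'v ob \<times> 'v qrel" where
  "base_cat T Q \<zeta> \<theta>\<^sub>0 \<theta> = (\<lambda>(X, \<alpha>). (base_ob \<theta>\<^sub>0 X, base_rel \<theta> X (lift_ob T Q \<zeta> X) \<alpha>))"

definition base_alg ::
  "'v::grothendieck_universe monad \<Rightarrow> 'v quantaloid \<Rightarrow> ('v \<Rightarrow> 'v) \<Rightarrow> ('v \<Rightarrow> 'v) \<Rightarrow>
   ('v \<Rightarrow> 'v \<Rightarrow> 'v \<Rightarrow> 'v) \<Rightarrow> 'v ob \<times> ('v \<Rightarrow> 'v) \<Rightarrow> 'v ob \<times> ('v \<Rightarrow> 'v)" where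
  "base_alg T Q \<zeta> \<theta>\<^sub>0 \<theta> =
     (\<lambda>(X, p). (base_ob \<theta>\<^sub>0 X, compose (und (lift_ob T Q \<zeta> X)) (base_psh Q \<theta>\<^sub>0 \<theta> X) p))"

text \<open>The two compatibility hypotheses. Both sides are compared over the array map of
  \<open>T B X\<close>, which agrees with that of \<open>B T X\<close>.\<close>

definition ext_compatible ::
  "'v::grothendieck_universe monad \<Rightarrow> 'v quantaloid \<Rightarrow> 'v quantaloid \<Rightarrow> ('v \<Rightarrow> 'v) \<Rightarrow> ('v \<Rightarrow> 'v) \<Rightarrow>
   ('v \<Rightarrow> 'v) \<Rightarrow> ('v \<Rightarrow> 'v \<Rightarrow> 'v \<Rightarrow> 'v) \<Rightarrow>
   ('v ob \<Rightarrow> 'v ob \<Rightarrow> 'v qrel \<Rightarrow> 'v qrel) \<Rightarrow> ('v ob \<Rightarrow> 'v ob \<Rightarrow> 'v qrel \<Rightarrow> 'v qrel) \<Rightarrow> bool" where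
  "ext_compatible T Q R \<zeta> \<eta> \<theta>\<^sub>0 \<theta> E F \<longleftrightarrow>
    (let L = lift_ob T Q \<zeta>; M = lift_ob T R \<eta>; B = base_ob \<theta>\<^sub>0 in
     \<forall>X\<in>slice_ob Q. \<forall>Y\<in>slice_ob Q. \<forall>\<phi>\<in>qrels Q X Y.
       qrel_le R (M (B X)) (M (B Y))
         (F (B X) (B Y) (base_rel \<theta> X Y \<phi>)) (base_rel \<theta> (L X) (L Y) (E X Y \<phi>)))"

definition law_compatible ::
  "'v::grothendieck_universe monad \<Rightarrow> 'v quantaloid \<Rightarrow> 'v quantaloid \<Rightarrow> ('v \<Rightarrow> 'v) \<Rightarrow> ('v \<Rightarrow> 'v) \<Rightarrow>
   ('v \<Rightarrow> 'v) \<Rightarrow> ('v \<Rightarrow> 'v \<Rightarrow> 'v \<Rightarrow> 'v) \<Rightarrow> ('v ob \<Rightarrow> 'v \<Rightarrow> 'v) \<Rightarrow> ('v ob \<Rightarrow> 'v \<Rightarrow> 'v) \<Rightarrow> bool" where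
  "law_compatible T Q R \<zeta> \<eta> \<theta>\<^sub>0 \<theta> \<Lambda> \<kappa> \<longleftrightarrow>
    (let L = lift_ob T Q \<zeta>; M = lift_ob T R \<eta>; B = base_ob \<theta>\<^sub>0; P = psh Q in
     \<forall>X\<in>slice_ob Q.
       psh_le R (M (B X)) (und (L (P X)))
         (compose (und (L (P X))) (\<kappa> (B X)) (Tm T (B (P X)) (psh R (B X)) (base_psh Q \<theta>\<^sub>0 \<theta> X)))
         (compose (und (L (P X))) (base_psh Q \<theta>\<^sub>0 \<theta> (L X)) (\<Lambda> X)))"

end

theory Submission
  imports Defs
begin

text \<open>
  A relation \<open>\<phi> : X \<rightarrow> Y\<close> and the map \<open>y \<mapsto> \<phi> _ y\<close> from \<open>Y\<close> to the presheaves on \<open>X\<close> are the same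
  data, and this bijection (\<open>psh_of_rel_bij_betw\<close>) is the engine of the proof. Under it the pointwise
  orders agree, the identity relation becomes the unit of the presheaf monad, composition with a
  cograph becomes precomposition with a map or application of \<open>f\<^sub>!\<close>, and relational composition becomes
  Kleisli composition (\<open>kleisli_compose_of_rel\<close>); in other words, relations form the dual of the
  Kleisli category of the presheaf monad. The correspondence of an extension with a law says that
  \<open>E \<phi>\<close> becomes \<open>\<Lambda> \<cdot> T \<phi>\<close>.

  Hence each axiom of a \<open>(T, E, Q)\<close>-category is, read through the bijection, an axiom of a
  \<open>(\<Lambda>, Q)\<close>-algebra, and likewise for morphisms. This gives the two isomorphisms of categories
  (\<open>cat_to_alg_isomorphism\<close>).

  A lax homomorphism acts on relations entrywise, and under the bijection this is postcomposition with
  \<open>\<theta>\<^sub>X\<close> (\<open>base_psh_compose_of_rel\<close>). So the inequality between extensions at a relation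
  \<open>\<phi> : X \<rightarrow> Y\<close> is the inequality between laws precomposed with \<open>T\<close> of the map \<open>Y \<rightarrow> PX\<close> that \<open>\<phi>\<close>
  names. The evaluation relation names the identity, so the inequality between laws is its instance at
  evaluation, and conversely implies it everywhere (\<open>compatible_iff\<close>).

  Evaluated at points, the axioms of a \<open>(T, E, Q)\<close>-category are \<open>1 \<le> \<alpha>(x, e x)\<close> and
  \<open>E \<alpha>(t, s) \<circ> \<alpha>(x, t) \<le> \<alpha>(x, m s)\<close>. Applying \<open>\<theta>\<close> preserves the first because
  \<open>1 \<le> \<theta> 1\<close>, and the second because \<open>F(\<theta> \<alpha>) \<le> \<theta>(E \<alpha>)\<close> and \<open>\<theta> v \<circ> \<theta> u \<le> \<theta>(v \<circ> u)\<close>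
  (\<open>base_Obj\<close>). The functor between the categories of algebras is then the same functor carried along
  the two isomorphisms, since the square that they form with the two changes of base commutes
  (\<open>base_square\<close>).
\<close>

section \<open>Codes of presheaves\<close>

lemma elts_vset:
  assumes "small A"
  shows "elts (vset A) = A"
proof -
  obtain x where x: "elts x = A"
    using assms by (auto simp: small_def)
  have "vset A = x"
    unfolding vset_def by (rule the_equality) (use x elts_inject in auto)
  then show ?thesis using x by simp
qed

lemma small_subset: "small B \<Longrightarrow> A \<subseteq> B \<Longrightarrow> small A"
  unfolding small_def by (auto intro: elts_subset)

lemma small_pair: "small {x, y}"
  unfolding small_def by (rule elts_pair)

lemma small_UN:
  fixes A :: "'v::grothendieck_universe set" and f :: "'v \<Rightarrow> 'v set"
  assumes "small A" and "\<And>y. y \<in> A \<Longrightarrow> small (f y)"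
  shows "small (\<Union>y\<in>A. f y)"
proof -
  have "small (\<Union>y\<in>elts (vset A). elts (vset (f y)))"
    by (simp add: small_def elts_UN)
  then show ?thesis
    using assms by (simp add: elts_vset)
qed

lemma small_image:
  fixes A :: "'v::grothendieck_universe set" and f :: "'v \<Rightarrow> 'v"
  assumes "small A"
  shows "small (f ` A)"
proof -
  \<comment> \<open>Singletons are small as degenerate pairs.\<close>
  have "small (\<Union>y\<in>A. {f y, f y})"
    by (rule small_UN[OF assms small_pair])
  moreover have "(\<Union>y\<in>A. {f y, f y}) = f ` A" by auto
  ultimately show ?thesis by simp
qed

lemma small_codes_of_subsets:
  assumes "small A"
  shows "small {w. elts w \<subseteq> A}"
  using elts_Pow[of "vset A"] assms by (simp add: elts_vset flip: small_def)

lemma vset_inject: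
  assumes "small A" "small B"
  shows "vset A = vset B \<longleftrightarrow> A = B"
proof
  assume "vset A = vset B"
  then have "elts (vset A) = elts (vset B)" by (rule arg_cong)
  then show "A = B" by (simp only: elts_vset assms)
qed simp

lemma vpair_inject [simp]: "vpair a b = vpair c d \<longleftrightarrow> a = c \<and> b = d"
proof -
  have small_singleton: "small {x}" for x :: 'a
    using small_pair[of x x] by simp
  have "vpair a b = vpair c d \<longleftrightarrow> {vset {a}, vset {a, b}} = {vset {c}, vset {c, d}}"
    unfolding vpair_def by (rule vset_inject[OF small_pair small_pair])
  also have "\<dots> \<longleftrightarrow> {a} = {c} \<and> {a, b} = {c, d} \<or> {a} = {c, d} \<and> {a, b} = {c}"
    by (simp only: doubleton_eq_iff vset_inject[OF small_pair small_pair]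
        vset_inject[OF small_singleton small_singleton]
        vset_inject[OF small_singleton small_pair] vset_inject[OF small_pair small_singleton])
  also have "\<dots> \<longleftrightarrow> a = c \<and> b = d"
    by (auto simp: doubleton_eq_iff)
  finally show ?thesis .
qed

lemma psh_arr_code [simp]: "psh_arr (psh_code X s \<sigma>) = s"
  unfolding psh_arr_def psh_code_def by (rule the_equality) auto

lemma psh_val_code:
  assumes "small X" and "x \<in> X"
  shows "psh_val (psh_code X s \<sigma>) x = \<sigma> x"
proof -
  have "elts (vset ((\<lambda>x. vpair x (\<sigma> x)) ` X)) = (\<lambda>x. vpair x (\<sigma> x)) ` X"
    by (intro elts_vset small_image assms(1))
  then show ?thesis
    unfolding psh_val_def psh_code_def using assms(2) by (intro the_equality) auto
qed

text \<open>
  The presheaves on a small family of objects form a set again because each of them is a pair of an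
  object and a code of a subset of one fixed small set of pairs.
\<close>

lemma small_psh_set:
  assumes "small_quantaloid Q" and X: "X \<in> slice_ob Q"
  shows "small (psh_set Q X)"
proof -
  have obs: "small (Ob Q)"
    and homs: "\<And>s t. s \<in> Ob Q \<Longrightarrow> t \<in> Ob Q \<Longrightarrow> small (carrier (Hom Q s t))"
    using assms(1) by (auto simp: small_quantaloid_def)
  have arr: "arr X x \<in> Ob Q" if "x \<in> und X" for x
    using X that by (auto simp: slice_ob_def)
  have und: "small (und X)" using X by (simp add: slice_ob_def)
  define G where "G = (\<Union>s\<in>Ob Q. \<Union>x\<in>und X. vpair x ` carrier (Hom Q (arr X x) s))"
  have "small G"
    unfolding G_def by (intro small_UN small_image obs und homs arr)
  then have "small (\<Union>s\<in>Ob Q. vpair s ` {w. elts w \<subseteq> G})"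
    by (intro small_UN small_image small_codes_of_subsets obs)
  moreover have "psh_set Q X \<subseteq> (\<Union>s\<in>Ob Q. vpair s ` {w. elts w \<subseteq> G})"
  proof
    fix p assume "p \<in> psh_set Q X"
    then obtain s \<sigma> where p: "p = psh_code (und X) s \<sigma>" "s \<in> Ob Q"
        and \<sigma>: "\<sigma> \<in> (\<Pi>\<^sub>E x\<in>und X. carrier (Hom Q (arr X x) s))"
      by (auto simp: psh_set_def)
    have "(\<lambda>x. vpair x (\<sigma> x)) ` und X \<subseteq> G"
      unfolding G_def by (intro image_subsetI UN_I[OF p(2)] UN_I imageI) (use \<sigma> in auto)
    then have "elts (vset ((\<lambda>x. vpair x (\<sigma> x)) ` und X)) \<subseteq> G"
      by (simp add: elts_vset small_image und)
    then show "p \<in> (\<Union>s\<in>Ob Q. vpair s ` {w. elts w \<subseteq> G})"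
      unfolding p(1) psh_code_def by (intro UN_I[OF p(2)] imageI CollectI)
  qed
  ultimately show ?thesis by (rule small_subset)
qed

section \<open>Order and composition in a quantaloid\<close>

locale quantaloid =
  fixes Q :: "'v::grothendieck_universe quantaloid"
  assumes quantaloid: "small_quantaloid Q"
begin

lemmas small_quantaloidD =
  quantaloid[unfolded small_quantaloid_def, THEN conjunct1, rule_format]
  quantaloid[unfolded small_quantaloid_def, THEN conjunct2, THEN conjunct1, rule_format]
  quantaloid[unfolded small_quantaloid_def, THEN conjunct2, THEN conjunct2, THEN conjunct1, rule_format]
  quantaloid[unfolded small_quantaloid_def, THEN conjunct2, THEN conjunct2, THEN conjunct2, THEN conjunct1, rule_format]
  quantaloid[unfolded small_quantaloid_def, THEN conjunct2, THEN conjunct2, THEN conjunct2, THEN conjunct2, THEN conjunct1, rule_format]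
  quantaloid[unfolded small_quantaloid_def, THEN conjunct2, THEN conjunct2, THEN conjunct2, THEN conjunct2, THEN conjunct2, THEN conjunct1, rule_format]
  quantaloid[unfolded small_quantaloid_def, THEN conjunct2, THEN conjunct2, THEN conjunct2, THEN conjunct2, THEN conjunct2, THEN conjunct2, THEN conjunct1, rule_format]
  quantaloid[unfolded small_quantaloid_def, THEN conjunct2, THEN conjunct2, THEN conjunct2, THEN conjunct2, THEN conjunct2, THEN conjunct2, THEN conjunct2, rule_format]

lemma hom_complete_lattice:
  "s \<in> Ob Q \<Longrightarrow> t \<in> Ob Q \<Longrightarrow> complete_lattice (Hom Q s t)"
  by (rule small_quantaloidD(2)[THEN conjunct2])

lemma One_closed [simp]: "s \<in> Ob Q \<Longrightarrow> One Q s \<in> carrier (Hom Q s s)"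
  by (rule small_quantaloidD(3))

lemma Comp_closed [simp]:
  "\<lbrakk>r \<in> Ob Q; s \<in> Ob Q; t \<in> Ob Q; u \<in> carrier (Hom Q r s); v \<in> carrier (Hom Q s t)\<rbrakk>
    \<Longrightarrow> Comp Q r s t v u \<in> carrier (Hom Q r t)"
  by (rule small_quantaloidD(4))

lemma Comp_One_right:
  "\<lbrakk>s \<in> Ob Q; t \<in> Ob Q; u \<in> carrier (Hom Q s t)\<rbrakk> \<Longrightarrow> Comp Q s s t u (One Q s) = u"
  by (rule small_quantaloidD(5)[THEN conjunct1])

lemma Comp_One_left:
  "\<lbrakk>s \<in> Ob Q; t \<in> Ob Q; u \<in> carrier (Hom Q s t)\<rbrakk> \<Longrightarrow> Comp Q s t t (One Q t) u = u"
  by (rule small_quantaloidD(5)[THEN conjunct2])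

lemma Comp_assoc:
  "\<lbrakk>q \<in> Ob Q; r \<in> Ob Q; s \<in> Ob Q; t \<in> Ob Q; u \<in> carrier (Hom Q q r);
    v \<in> carrier (Hom Q r s); w \<in> carrier (Hom Q s t)\<rbrakk>
    \<Longrightarrow> Comp Q q r t (Comp Q r s t w v) u = Comp Q q s t w (Comp Q q r s v u)"
  by (rule small_quantaloidD(6))

lemma Comp_qsup_right:
  "\<lbrakk>r \<in> Ob Q; s \<in> Ob Q; t \<in> Ob Q; v \<in> carrier (Hom Q s t); A \<subseteq> carrier (Hom Q r s)\<rbrakk>
    \<Longrightarrow> Comp Q r s t v (qsup Q r s A) = qsup Q r t ((\<lambda>u. Comp Q r s t v u) ` A)"
  by (rule small_quantaloidD(7))

lemma Comp_qsup_left: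
  "\<lbrakk>r \<in> Ob Q; s \<in> Ob Q; t \<in> Ob Q; u \<in> carrier (Hom Q r s); A \<subseteq> carrier (Hom Q s t)\<rbrakk>
    \<Longrightarrow> Comp Q r s t (qsup Q s t A) u = qsup Q r t ((\<lambda>v. Comp Q r s t v u) ` A)"
  by (rule small_quantaloidD(8))

context
  fixes s t
  assumes s: "s \<in> Ob Q" and t: "t \<in> Ob Q"
begin

interpretation hom: complete_lattice "Hom Q s t"
  using s t by (rule hom_complete_lattice)

lemma qle_refl: "u \<in> carrier (Hom Q s t) \<Longrightarrow> qle Q s t u u"
  by simp

lemma qle_trans:
  "\<lbrakk>qle Q s t u v; qle Q s t v w; u \<in> carrier (Hom Q s t); v \<in> carrier (Hom Q s t);
    w \<in> carrier (Hom Q s t)\<rbrakk> \<Longrightarrow> qle Q s t u w"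
  by (rule hom.le_trans)

lemma qle_antisym:
  "\<lbrakk>qle Q s t u v; qle Q s t v u; u \<in> carrier (Hom Q s t); v \<in> carrier (Hom Q s t)\<rbrakk> \<Longrightarrow> u = v"
  by (rule hom.le_antisym)

lemma qsup_closed [simp]: "A \<subseteq> carrier (Hom Q s t) \<Longrightarrow> qsup Q s t A \<in> carrier (Hom Q s t)"
  by simp

lemma qsup_le_iff:
  assumes "A \<subseteq> carrier (Hom Q s t)" and "d \<in> carrier (Hom Q s t)"
  shows "qle Q s t (qsup Q s t A) d \<longleftrightarrow> (\<forall>a\<in>A. qle Q s t a d)"
proof
  assume d: "qle Q s t (qsup Q s t A) d"
  show "\<forall>a\<in>A. qle Q s t a d"
  proof
    fix a assume "a \<in> A"
    then show "qle Q s t a d"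
      using hom.sup_upper[of A a] d assms qle_trans[of a "qsup Q s t A" d] by auto
  qed
next
  assume "\<forall>a\<in>A. qle Q s t a d"
  then show "qle Q s t (qsup Q s t A) d"
    using assms by (intro hom.sup_least) (auto simp: Upper_def)
qed

text \<open>
  Equality of suprema, in particular of nested ones, is proved below by comparing upper bounds.
\<close>

lemma eqI_upper_bounds:
  assumes "u \<in> carrier (Hom Q s t)" and "v \<in> carrier (Hom Q s t)"
    and "\<And>d. d \<in> carrier (Hom Q s t) \<Longrightarrow> qle Q s t u d \<longleftrightarrow> qle Q s t v d"
  shows "u = v"
  using assms qle_antisym qle_refl by blast

lemma qsup_singleton: "u \<in> carrier (Hom Q s t) \<Longrightarrow> qsup Q s t {u} = u"
  by simp

lemma qbot_closed [simp]: "qbot Q s t \<in> carrier (Hom Q s t)"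
  by simp

lemma qbot_least: "u \<in> carrier (Hom Q s t) \<Longrightarrow> qle Q s t (qbot Q s t) u"
  by simp

lemma qsup_empty: "qsup Q s t {} = qbot Q s t"
  by (rule eqI_upper_bounds) (auto simp: qsup_le_iff qbot_least)

text \<open>
  The entries of a cograph off the graph are bottom; this removes them from the suprema in which they
  occur.
\<close>

lemma qsup_restrict:
  assumes "\<And>i. i \<in> I \<Longrightarrow> P i \<Longrightarrow> a i \<in> carrier (Hom Q s t)"
  shows "qsup Q s t ((\<lambda>i. if P i then a i else qbot Q s t) ` I) = qsup Q s t (a ` {i \<in> I. P i})"
proof -
  have "(\<lambda>i. if P i then a i else qbot Q s t) ` I \<subseteq> carrier (Hom Q s t)"
    and "a ` {i \<in> I. P i} \<subseteq> carrier (Hom Q s t)"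
    using assms by auto
  then show ?thesis
    by (intro eqI_upper_bounds) (auto simp: qsup_le_iff qbot_least)
qed

end

lemma Comp_qbot_right:
  "\<lbrakk>r \<in> Ob Q; s \<in> Ob Q; t \<in> Ob Q; v \<in> carrier (Hom Q s t)\<rbrakk>
    \<Longrightarrow> Comp Q r s t v (qbot Q r s) = qbot Q r t"
  using Comp_qsup_right[of r s t v "{}"] by (simp add: qsup_empty)

lemma Comp_qbot_left:
  "\<lbrakk>r \<in> Ob Q; s \<in> Ob Q; t \<in> Ob Q; u \<in> carrier (Hom Q r s)\<rbrakk>
    \<Longrightarrow> Comp Q r s t (qbot Q s t) u = qbot Q r t"
  using Comp_qsup_left[of r s t u "{}"] by (simp add: qsup_empty)

text \<open>Monotonicity is preservation of the supremum of a comparable pair.\<close>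

lemma Comp_mono_left:
  assumes "r \<in> Ob Q" "s \<in> Ob Q" "t \<in> Ob Q" "u \<in> carrier (Hom Q r s)"
    and vw: "v \<in> carrier (Hom Q s t)" "w \<in> carrier (Hom Q s t)" "qle Q s t v w"
  shows "qle Q r t (Comp Q r s t v u) (Comp Q r s t w u)"
proof -
  have "qsup Q s t {v, w} = w"
    using assms by (intro eqI_upper_bounds) (auto simp: qsup_le_iff intro: qle_trans)
  then have "Comp Q r s t w u = qsup Q r t {Comp Q r s t v u, Comp Q r s t w u}"
    using Comp_qsup_left[of r s t u "{v, w}"] assms by simp
  then have "qle Q r t (qsup Q r t {Comp Q r s t v u, Comp Q r s t w u}) (Comp Q r s t w u)"
    using assms by (metis Comp_closed qle_refl)
  then show ?thesis
    using assms by (subst (asm) qsup_le_iff) auto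
qed

section \<open>Composition of relations\<close>

lemma slice_ob_small: "X \<in> slice_ob Q \<Longrightarrow> small (und X)"
  by (simp add: slice_ob_def)

lemma arr_closed [simp]: "X \<in> slice_ob Q \<Longrightarrow> x \<in> und X \<Longrightarrow> arr X x \<in> Ob Q"
  by (auto simp: slice_ob_def)

lemma qrels_closed [simp]:
  "\<phi> \<in> qrels Q X Y \<Longrightarrow> x \<in> und X \<Longrightarrow> y \<in> und Y \<Longrightarrow> \<phi> x y \<in> carrier (Hom Q (arr X x) (arr Y y))"
  unfolding qrels_def by fastforce

lemma qrels_eqI:
  assumes "\<phi> \<in> qrels Q X Y" and "\<psi> \<in> qrels Q X Y"
    and "\<And>x y. x \<in> und X \<Longrightarrow> y \<in> und Y \<Longrightarrow> \<phi> x y = \<psi> x y"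
  shows "\<phi> = \<psi>"
proof (rule PiE_ext)
  show "\<phi> \<in> (\<Pi>\<^sub>E x\<in>und X. \<Pi>\<^sub>E y\<in>und Y. carrier (Hom Q (arr X x) (arr Y y)))"
    and "\<psi> \<in> (\<Pi>\<^sub>E x\<in>und X. \<Pi>\<^sub>E y\<in>und Y. carrier (Hom Q (arr X x) (arr Y y)))"
    using assms by (auto simp: qrels_def)
next
  fix x assume "x \<in> und X"
  then show "\<phi> x = \<psi> x"
    using assms unfolding qrels_def by (intro PiE_ext[of "\<phi> x" "und Y"]) auto
qed

lemma slice_homD:
  "f \<in> slice_hom X Y \<Longrightarrow> x \<in> und X \<Longrightarrow> f x \<in> und Y"
  "f \<in> slice_hom X Y \<Longrightarrow> x \<in> und X \<Longrightarrow> arr Y (f x) = arr X x"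
  by (auto simp: slice_hom_def)

lemma cograph_in_qrels:
  assumes "X \<in> slice_ob Q" "Y \<in> slice_ob Q" "f \<in> slice_hom X Y"
  shows "cograph Q X Y f \<in> qrels Q Y X"
proof -
  have "(if f x = y then One Q (arr X x) else qbot Q (arr Y y) (arr X x))
          \<in> carrier (Hom Q (arr Y y) (arr X x))" if "x \<in> und X" "y \<in> und Y" for x y
    using that assms slice_homD(2)[OF assms(3) that(1)] by auto
  then show ?thesis
    unfolding qrels_def cograph_def by (intro restrict_PiE_iff[THEN iffD2] ballI) auto
qed

lemma identity_slice_hom: "(\<lambda>x\<in>und X. x) \<in> slice_hom X X"
  by (auto simp: slice_hom_def)

lemma qrel_comp_terms:
  assumes "X \<in> slice_ob Q" "Y \<in> slice_ob Q" "Z \<in> slice_ob Q" "\<phi> \<in> qrels Q X Y" "\<psi> \<in> qrels Q Y Z"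
    and "x \<in> und X" "z \<in> und Z"
  shows "(\<lambda>y. Comp Q (arr X x) (arr Y y) (arr Z z) (\<psi> y z) (\<phi> x y)) ` und Y
           \<subseteq> carrier (Hom Q (arr X x) (arr Z z))"
  using assms by auto

lemma qrel_comp_in_qrels:
  assumes "X \<in> slice_ob Q" "Y \<in> slice_ob Q" "Z \<in> slice_ob Q" "\<phi> \<in> qrels Q X Y" "\<psi> \<in> qrels Q Y Z"
  shows "qrel_comp Q X Y Z \<psi> \<phi> \<in> qrels Q X Z"
  unfolding qrels_def qrel_comp_def
  using assms by (intro restrict_PiE_iff[THEN iffD2] ballI qsup_closed qrel_comp_terms) auto

lemma qrel_comp_apply_le_iff:
  assumes "X \<in> slice_ob Q" "Y \<in> slice_ob Q" "Z \<in> slice_ob Q" "\<phi> \<in> qrels Q X Y" "\<psi> \<in> qrels Q Y Z"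
    and "x \<in> und X" "z \<in> und Z" "d \<in> carrier (Hom Q (arr X x) (arr Z z))"
  shows "qle Q (arr X x) (arr Z z) (qrel_comp Q X Y Z \<psi> \<phi> x z) d \<longleftrightarrow>
    (\<forall>y\<in>und Y. qle Q (arr X x) (arr Z z) (Comp Q (arr X x) (arr Y y) (arr Z z) (\<psi> y z) (\<phi> x y)) d)"
  using assms qrel_comp_terms[OF assms(1-7)] by (simp add: qrel_comp_def qsup_le_iff)

lemma qrel_comp_le_iff:
  assumes "X \<in> slice_ob Q" "Y \<in> slice_ob Q" "Z \<in> slice_ob Q" "\<phi> \<in> qrels Q X Y" "\<psi> \<in> qrels Q Y Z"
    and "\<chi> \<in> qrels Q X Z"
  shows "qrel_le Q X Z (qrel_comp Q X Y Z \<psi> \<phi>) \<chi> \<longleftrightarrow>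
    (\<forall>x\<in>und X. \<forall>y\<in>und Y. \<forall>z\<in>und Z. qle Q (arr X x) (arr Z z)
       (Comp Q (arr X x) (arr Y y) (arr Z z) (\<psi> y z) (\<phi> x y)) (\<chi> x z))"
  using qrel_comp_apply_le_iff[OF assms(1-5)] assms(6) unfolding qrel_le_def by auto

text \<open>
  Composition preserves suprema on both sides, so either bracketing is the supremum of all triple
  composites. This is read off from the upper bounds.
\<close>

lemma qrel_comp_assoc:
  assumes ob: "W \<in> slice_ob Q" "X \<in> slice_ob Q" "Y \<in> slice_ob Q" "Z \<in> slice_ob Q"
    and rel: "\<phi> \<in> qrels Q W X" "\<psi> \<in> qrels Q X Y" "\<chi> \<in> qrels Q Y Z"
  shows "qrel_comp Q W X Z (qrel_comp Q X Y Z \<chi> \<psi>) \<phi> = qrel_comp Q W Y Z \<chi> (qrel_comp Q W X Y \<psi> \<phi>)"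
proof (rule qrels_eqI)
  show "qrel_comp Q W X Z (qrel_comp Q X Y Z \<chi> \<psi>) \<phi> \<in> qrels Q W Z"
    and "qrel_comp Q W Y Z \<chi> (qrel_comp Q W X Y \<psi> \<phi>) \<in> qrels Q W Z"
    using ob rel by (simp_all add: qrel_comp_in_qrels)
  then have closed: "qrel_comp Q W X Z (qrel_comp Q X Y Z \<chi> \<psi>) \<phi> w z \<in> carrier (Hom Q (arr W w) (arr Z z))"
      "qrel_comp Q W Y Z \<chi> (qrel_comp Q W X Y \<psi> \<phi>) w z \<in> carrier (Hom Q (arr W w) (arr Z z))"
    if "w \<in> und W" "z \<in> und Z" for w z
    using that by auto
  fix w z assume w: "w \<in> und W" and z: "z \<in> und Z"
  let ?C = "\<lambda>x y. Comp Q (arr W w) (arr Y y) (arr Z z) (\<chi> y z)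
              (Comp Q (arr W w) (arr X x) (arr Y y) (\<psi> x y) (\<phi> w x))"
  have outer: "qle Q (arr W w) (arr Z z)
        (Comp Q (arr W w) (arr X x) (arr Z z) (qrel_comp Q X Y Z \<chi> \<psi> x z) (\<phi> w x)) d
      \<longleftrightarrow> (\<forall>y\<in>und Y. qle Q (arr W w) (arr Z z) (?C x y) d)"
    if x: "x \<in> und X" and d: "d \<in> carrier (Hom Q (arr W w) (arr Z z))" for x d
  proof -
    let ?A = "(\<lambda>y. Comp Q (arr X x) (arr Y y) (arr Z z) (\<chi> y z) (\<psi> x y)) ` und Y"
    have A: "?A \<subseteq> carrier (Hom Q (arr X x) (arr Z z))"
      using ob rel x z by (intro qrel_comp_terms)
    have "Comp Q (arr W w) (arr X x) (arr Z z) (qrel_comp Q X Y Z \<chi> \<psi> x z) (\<phi> w x) =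
        qsup Q (arr W w) (arr Z z) ((\<lambda>v. Comp Q (arr W w) (arr X x) (arr Z z) v (\<phi> w x)) ` ?A)"
      using ob rel x z w A by (simp add: qrel_comp_def Comp_qsup_left)
    also have "(\<lambda>v. Comp Q (arr W w) (arr X x) (arr Z z) v (\<phi> w x)) ` ?A = ?C x ` und Y"
      unfolding image_image using ob rel x z w by (intro image_cong refl Comp_assoc) auto
    finally show ?thesis
      using ob rel x z w d by (simp add: qsup_le_iff image_subset_iff)
  qed
  have inner: "qle Q (arr W w) (arr Z z)
        (Comp Q (arr W w) (arr Y y) (arr Z z) (\<chi> y z) (qrel_comp Q W X Y \<psi> \<phi> w y)) d
      \<longleftrightarrow> (\<forall>x\<in>und X. qle Q (arr W w) (arr Z z) (?C x y) d)"
    if y: "y \<in> und Y" and d: "d \<in> carrier (Hom Q (arr W w) (arr Z z))" for y d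
  proof -
    let ?A = "(\<lambda>x. Comp Q (arr W w) (arr X x) (arr Y y) (\<psi> x y) (\<phi> w x)) ` und X"
    have A: "?A \<subseteq> carrier (Hom Q (arr W w) (arr Y y))"
      using ob rel w y by (intro qrel_comp_terms)
    have "Comp Q (arr W w) (arr Y y) (arr Z z) (\<chi> y z) (qrel_comp Q W X Y \<psi> \<phi> w y) =
        qsup Q (arr W w) (arr Z z) (Comp Q (arr W w) (arr Y y) (arr Z z) (\<chi> y z) ` ?A)"
      using ob rel y z w A by (simp add: qrel_comp_def Comp_qsup_right)
    then show ?thesis
      using ob rel y z w d by (simp add: qsup_le_iff image_subset_iff image_image)
  qed
  show "qrel_comp Q W X Z (qrel_comp Q X Y Z \<chi> \<psi>) \<phi> w z
      = qrel_comp Q W Y Z \<chi> (qrel_comp Q W X Y \<psi> \<phi>) w z"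
    by (rule eqI_upper_bounds[of "arr W w" "arr Z z"])
      (use ob rel w z closed outer inner in
        \<open>auto simp: qrel_comp_apply_le_iff qrel_comp_in_qrels\<close>)
qed

text \<open>
  Of the supremum over all \<open>y\<close> only the term at \<open>y = h z\<close> survives, and there the cograph is an
  identity. Composing with \<open>h\<^sup>\<circ>\<close> is thus substitution of \<open>h\<close>.
\<close>

lemma cograph_comp_apply:
  assumes ob: "X \<in> slice_ob Q" "Y \<in> slice_ob Q" "Z \<in> slice_ob Q"
    and \<phi>: "\<phi> \<in> qrels Q X Y" and h: "h \<in> slice_hom Z Y" and x: "x \<in> und X" and z: "z \<in> und Z"
  shows "qrel_comp Q X Y Z (cograph Q Z Y h) \<phi> x z = \<phi> x (h z)"
proof -
  have hz: "h z \<in> und Y" "arr Y (h z) = arr Z z"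
    using slice_homD[OF h z] by auto
  then have \<phi>hz: "\<phi> x (h z) \<in> carrier (Hom Q (arr X x) (arr Z z))"
    using qrels_closed[OF \<phi> x] by metis
  have "Comp Q (arr X x) (arr Y y) (arr Z z) (cograph Q Z Y h y z) (\<phi> x y) =
      (if h z = y then \<phi> x y else qbot Q (arr X x) (arr Z z))" if y: "y \<in> und Y" for y
    using ob \<phi> x z y hz \<phi>hz
    by (auto simp: cograph_def Comp_One_left Comp_qbot_left)
  then have "qrel_comp Q X Y Z (cograph Q Z Y h) \<phi> x z =
      qsup Q (arr X x) (arr Z z) ((\<lambda>y. if h z = y then \<phi> x y else qbot Q (arr X x) (arr Z z)) ` und Y)"
    using x z by (simp add: qrel_comp_def)
  also have "\<dots> = qsup Q (arr X x) (arr Z z) (\<phi> x ` {y \<in> und Y. h z = y})"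
    using ob x z \<phi>hz by (intro qsup_restrict) auto
  also have "{y \<in> und Y. h z = y} = {h z}"
    using hz by auto
  finally show ?thesis
    using ob x z \<phi>hz by (simp add: qsup_singleton)
qed

text \<open>
  On the other side the cograph selects a fibre of \<open>f\<close>, as \<open>f\<^sub>!\<close> does for presheaves.
\<close>

lemma comp_cograph_apply:
  assumes ob: "X \<in> slice_ob Q" "Y \<in> slice_ob Q" "Z \<in> slice_ob Q"
    and \<alpha>: "\<alpha> \<in> qrels Q X Z" and f: "f \<in> slice_hom X Y" and y: "y \<in> und Y" and z: "z \<in> und Z"
  shows "qrel_comp Q Y X Z \<alpha> (cograph Q X Y f) y z =
    qsup Q (arr Y y) (arr Z z) ((\<lambda>x. \<alpha> x z) ` {x \<in> und X. f x = y})"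
proof -
  have "Comp Q (arr Y y) (arr X x) (arr Z z) (\<alpha> x z) (cograph Q X Y f y x) =
      (if f x = y then \<alpha> x z else qbot Q (arr Y y) (arr Z z))" if x: "x \<in> und X" for x
    using ob \<alpha> x z y slice_homD[OF f x] qrels_closed[OF \<alpha> x z]
    by (auto simp: cograph_def Comp_One_right Comp_qbot_right)
  then have "qrel_comp Q Y X Z \<alpha> (cograph Q X Y f) y z =
      qsup Q (arr Y y) (arr Z z) ((\<lambda>x. if f x = y then \<alpha> x z else qbot Q (arr Y y) (arr Z z)) ` und X)"
    using y z by (simp add: qrel_comp_def)
  also have "\<dots> = qsup Q (arr Y y) (arr Z z) ((\<lambda>x. \<alpha> x z) ` {x \<in> und X. f x = y})"
    using ob y z qrels_closed[OF \<alpha> _ z] slice_homD(2)[OF f]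
    by (intro qsup_restrict) fastforce+
  finally show ?thesis .
qed

text \<open>
  The suprema over the fibres of \<open>f\<close> disappear: a point \<open>y\<close> with a point \<open>x\<close> of its fibre is just the
  point \<open>x\<close>. In this form inequalities that define morphisms can be composed.
\<close>

lemma comp_cograph_le_iff:
  assumes ob: "X \<in> slice_ob Q" "Y \<in> slice_ob Q" "Z \<in> slice_ob Q"
    and \<alpha>: "\<alpha> \<in> qrels Q X Z" and \<beta>: "\<beta> \<in> qrels Q Y Z" and f: "f \<in> slice_hom X Y"
  shows "qrel_le Q Y Z (qrel_comp Q Y X Z \<alpha> (cograph Q X Y f)) \<beta> \<longleftrightarrow>
    (\<forall>x\<in>und X. \<forall>z\<in>und Z. qle Q (arr X x) (arr Z z) (\<alpha> x z) (\<beta> (f x) z))"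
proof -
  have "qle Q (arr Y y) (arr Z z) (qrel_comp Q Y X Z \<alpha> (cograph Q X Y f) y z) (\<beta> y z) \<longleftrightarrow>
      (\<forall>x\<in>und X. f x = y \<longrightarrow> qle Q (arr X x) (arr Z z) (\<alpha> x z) (\<beta> y z))"
    if y: "y \<in> und Y" and z: "z \<in> und Z" for y z
  proof -
    have "(\<lambda>x. \<alpha> x z) ` {x \<in> und X. f x = y} \<subseteq> carrier (Hom Q (arr Y y) (arr Z z))"
      using qrels_closed[OF \<alpha> _ z] slice_homD(2)[OF f] by fastforce
    then show ?thesis
      using ob y z \<beta> slice_homD(2)[OF f]
      by (auto simp: comp_cograph_apply[OF ob \<alpha> f y z] qsup_le_iff)
  qed
  then show ?thesis
    unfolding qrel_le_def using slice_homD(1)[OF f] by blast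
qed

lemma qrel_id_le_iff:
  assumes X: "X \<in> slice_ob Q" and \<chi>: "\<chi> \<in> qrels Q X X"
  shows "qrel_le Q X X (qrel_id Q X) \<chi> \<longleftrightarrow> (\<forall>x\<in>und X. qle Q (arr X x) (arr X x) (One Q (arr X x)) (\<chi> x x))"
  using X qrels_closed[OF \<chi>] unfolding qrel_le_def qrel_id_def cograph_def
  by (auto simp: qbot_least)

section \<open>Relations as maps into presheaves\<close>

lemma psh_set_iff:
  assumes "X \<in> slice_ob Q"
  shows "p \<in> psh_set Q X \<longleftrightarrow> (\<exists>s\<in>Ob Q. \<exists>\<sigma>\<in>(\<Pi>\<^sub>E x\<in>und X. carrier (Hom Q (arr X x) s)). p = psh_code (und X) s \<sigma>)"
  unfolding psh_set_def by auto

lemma psh_setD: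
  assumes X: "X \<in> slice_ob Q" and p: "p \<in> psh_set Q X"
  shows "psh_arr p \<in> Ob Q"
    and "x \<in> und X \<Longrightarrow> psh_val p x \<in> carrier (Hom Q (arr X x) (psh_arr p))"
    and "psh_code (und X) (psh_arr p) (\<lambda>x\<in>und X. psh_val p x) = p"
proof -
  obtain s \<sigma> where s: "s \<in> Ob Q" and \<sigma>: "\<sigma> \<in> (\<Pi>\<^sub>E x\<in>und X. carrier (Hom Q (arr X x) s))"
      and p: "p = psh_code (und X) s \<sigma>"
    using p psh_set_iff[OF X] by auto
  have val: "psh_val p x = \<sigma> x" if "x \<in> und X" for x
    using that p psh_val_code slice_ob_small[OF X] by metis
  have "(\<lambda>x\<in>und X. psh_val p x) = \<sigma>"
    using val \<sigma> by (auto intro!: ext simp: restrict_def PiE_def extensional_def)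
  then show "psh_code (und X) (psh_arr p) (\<lambda>x\<in>und X. psh_val p x) = p"
    by (simp add: p)
  show "psh_arr p \<in> Ob Q" using s p by simp
  show "psh_val p x \<in> carrier (Hom Q (arr X x) (psh_arr p))" if "x \<in> und X"
    using val[OF that] \<sigma> that p by auto
qed

lemma und_psh [simp]: "und (psh Q X) = psh_set Q X"
  by (simp add: psh_def)

lemma arr_psh [simp]: "p \<in> psh_set Q X \<Longrightarrow> arr (psh Q X) p = psh_arr p"
  by (simp add: psh_def)

lemma psh_slice_ob [simp]: "X \<in> slice_ob Q \<Longrightarrow> psh Q X \<in> slice_ob Q"
  using small_psh_set[OF quantaloid, of X] psh_setD(1)[of X]
  by (auto simp: slice_ob_def psh_def)

lemma psh_of_rel_in_psh_set:
  assumes "X \<in> slice_ob Q" "Y \<in> slice_ob Q" "\<phi> \<in> qrels Q X Y" "y \<in> und Y"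
  shows "psh_of_rel X Y \<phi> y \<in> psh_set Q X"
  using assms unfolding psh_set_iff[OF assms(1)] psh_of_rel_def
  by (intro bexI[of _ "arr Y y"] bexI[of _ "\<lambda>x\<in>und X. \<phi> x y"]) auto

lemma psh_arr_of_rel [simp]: "y \<in> und Y \<Longrightarrow> psh_arr (psh_of_rel X Y \<phi> y) = arr Y y"
  by (simp add: psh_of_rel_def)

lemma psh_val_of_rel:
  "X \<in> slice_ob Q \<Longrightarrow> x \<in> und X \<Longrightarrow> y \<in> und Y \<Longrightarrow> psh_val (psh_of_rel X Y \<phi> y) x = \<phi> x y"
  by (simp add: psh_of_rel_def psh_val_code slice_ob_small)

lemma psh_of_rel_slice_hom:
  assumes "X \<in> slice_ob Q" "Y \<in> slice_ob Q" "\<phi> \<in> qrels Q X Y"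
  shows "psh_of_rel X Y \<phi> \<in> slice_hom Y (psh Q X)"
  using psh_of_rel_in_psh_set[OF assms]
  by (auto simp: slice_hom_def psh_of_rel_def)

lemma psh_le_of_rel_iff:
  assumes "X \<in> slice_ob Q"
  shows "psh_le Q X (und Y) (psh_of_rel X Y \<phi>) (psh_of_rel X Y \<psi>) \<longleftrightarrow> qrel_le Q X Y \<phi> \<psi>"
  using assms unfolding psh_le_def qrel_le_def by (auto simp: psh_val_of_rel)

text \<open>
  A presheaf is determined by its array and its values, and a map over the object set has no choice
  for the array, so the values at each \<open>y\<close> are the only data of a map into presheaves.
\<close>

lemma psh_of_rel_bij_betw:
  assumes X: "X \<in> slice_ob Q" and Y: "Y \<in> slice_ob Q"
  shows "bij_betw (psh_of_rel X Y) (qrels Q X Y) (slice_hom Y (psh Q X))"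
proof (rule bij_betw_byWitness)
  let ?rel = "\<lambda>f. \<lambda>x\<in>und X. \<lambda>y\<in>und Y. psh_val (f y) x"
  have rel_closed: "?rel f \<in> qrels Q X Y" if "f \<in> slice_hom Y (psh Q X)" for f
    unfolding qrels_def
  proof (intro restrict_PiE_iff[THEN iffD2] ballI)
    fix x y assume x: "x \<in> und X" and y: "y \<in> und Y"
    have "f y \<in> psh_set Q X" "psh_arr (f y) = arr Y y"
      using slice_homD[OF that y] by auto
    then show "psh_val (f y) x \<in> carrier (Hom Q (arr X x) (arr Y y))"
      using psh_setD(2)[OF X _ x] by metis
  qed
  show "\<forall>\<phi>\<in>qrels Q X Y. ?rel (psh_of_rel X Y \<phi>) = \<phi>"
  proof
    fix \<phi> assume \<phi>: "\<phi> \<in> qrels Q X Y"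
    show "?rel (psh_of_rel X Y \<phi>) = \<phi>"
      by (rule qrels_eqI[OF rel_closed[OF psh_of_rel_slice_hom[OF X Y \<phi>]] \<phi>])
        (simp add: psh_val_of_rel X)
  qed
  show "\<forall>f\<in>slice_hom Y (psh Q X). psh_of_rel X Y (?rel f) = f"
  proof
    fix f assume f: "f \<in> slice_hom Y (psh Q X)"
    have "psh_of_rel X Y (?rel f) y = f y" for y
    proof (cases "y \<in> und Y")
      case True
      have fy: "f y \<in> psh_set Q X" "psh_arr (f y) = arr Y y"
        using slice_homD[OF f True] by auto
      have "psh_of_rel X Y (?rel f) y = psh_code (und X) (arr Y y) (\<lambda>x\<in>und X. psh_val (f y) x)"
        using True by (simp add: psh_of_rel_def cong: restrict_cong)
      then show ?thesis
        using psh_setD(3)[OF X fy(1)] fy(2) by simp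
    next
      case False
      then show ?thesis
        using f by (auto simp: psh_of_rel_def slice_hom_def PiE_def extensional_def)
    qed
    then show "psh_of_rel X Y (?rel f) = f" by auto
  qed
  show "psh_of_rel X Y ` qrels Q X Y \<subseteq> slice_hom Y (psh Q X)"
    using psh_of_rel_slice_hom[OF X Y] by auto
  show "?rel ` slice_hom Y (psh Q X) \<subseteq> qrels Q X Y"
    using rel_closed by auto
qed

lemma psh_unit_eq_of_rel: "psh_unit Q X = psh_of_rel X X (qrel_id Q X)"
  unfolding psh_unit_def psh_of_rel_def qrel_id_def cograph_def
  by (intro restrict_ext arg_cong[of _ _ "psh_code _ _"]) auto

lemma psh_of_rel_precompose:
  assumes "X \<in> slice_ob Q" "Y \<in> slice_ob Q" "Z \<in> slice_ob Q" "\<phi> \<in> qrels Q X Y" "h \<in> slice_hom Z Y"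
  shows "compose (und Z) (psh_of_rel X Y \<phi>) h = psh_of_rel X Z (qrel_comp Q X Y Z (cograph Q Z Y h) \<phi>)"
  unfolding compose_def psh_of_rel_def
  using slice_homD[OF assms(5)]
  by (intro restrict_ext) (auto simp: cograph_comp_apply[OF assms] cong: restrict_cong)

lemma psh_map_compose_of_rel:
  assumes "X \<in> slice_ob Q" "Y \<in> slice_ob Q" "Z \<in> slice_ob Q" "\<alpha> \<in> qrels Q X Z" "f \<in> slice_hom X Y"
  shows "compose (und Z) (psh_map Q X Y f) (psh_of_rel X Z \<alpha>) =
    psh_of_rel Y Z (qrel_comp Q Y X Z \<alpha> (cograph Q X Y f))"
proof -
  have "psh_map Q X Y f (psh_of_rel X Z \<alpha> z) =
      psh_code (und Y) (arr Z z) (\<lambda>y\<in>und Y. qrel_comp Q Y X Z \<alpha> (cograph Q X Y f) y z)"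
    if z: "z \<in> und Z" for z
  proof -
    have "psh_val (psh_of_rel X Z \<alpha> z) ` {x \<in> und X. f x = y} = (\<lambda>x. \<alpha> x z) ` {x \<in> und X. f x = y}" for y
      using z assms(1) by (intro image_cong refl) (simp add: psh_val_of_rel)
    then show ?thesis
      using z psh_of_rel_in_psh_set[OF assms(1,3,4) z]
      by (simp add: psh_map_def comp_cograph_apply[OF assms] cong: restrict_cong)
  qed
  then show ?thesis
    unfolding compose_def psh_of_rel_def[of Y] by (intro restrict_ext) auto
qed

lemma eval_rel_in_qrels:
  assumes "X \<in> slice_ob Q"
  shows "eval_rel Q X \<in> qrels Q X (psh Q X)"
  using psh_setD(2)[OF assms] unfolding eval_rel_def qrels_def by auto

lemma psh_of_eval_rel:
  assumes "X \<in> slice_ob Q"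
  shows "psh_of_rel X (psh Q X) (eval_rel Q X) = (\<lambda>p\<in>psh_set Q X. p)"
  unfolding psh_of_rel_def und_psh
  using psh_setD(3)[OF assms] by (intro restrict_ext) (auto simp: eval_rel_def cong: restrict_cong)

text \<open>
  Every relation is the pullback of the evaluation relation along the map that it names. Together with
  associativity this reduces statements about the multiplication to statements about evaluation.
\<close>

lemma cograph_of_rel_comp_eval_rel:
  assumes "X \<in> slice_ob Q" "Y \<in> slice_ob Q" "\<phi> \<in> qrels Q X Y"
  shows "qrel_comp Q X (psh Q X) Y (cograph Q Y (psh Q X) (psh_of_rel X Y \<phi>)) (eval_rel Q X) = \<phi>"
proof (rule qrels_eqI)
  note f = psh_of_rel_slice_hom[OF assms]
  note \<epsilon> = eval_rel_in_qrels[OF assms(1)]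
  show "qrel_comp Q X (psh Q X) Y (cograph Q Y (psh Q X) (psh_of_rel X Y \<phi>)) (eval_rel Q X) \<in> qrels Q X Y"
    using assms f \<epsilon> by (intro qrel_comp_in_qrels cograph_in_qrels) auto
  show "\<phi> \<in> qrels Q X Y" by fact
  fix x y assume xy: "x \<in> und X" "y \<in> und Y"
  show "qrel_comp Q X (psh Q X) Y (cograph Q Y (psh Q X) (psh_of_rel X Y \<phi>)) (eval_rel Q X) x y = \<phi> x y"
    using assms xy f \<epsilon> psh_of_rel_in_psh_set[OF assms xy(2)]
    by (simp add: cograph_comp_apply) (simp add: eval_rel_def psh_val_of_rel)
qed

text \<open>
  The multiplication composes with the evaluation relation: both take a supremum over all presheaves
  \<open>p\<close> of the value at \<open>p\<close> after the value of \<open>p\<close> at \<open>x\<close>.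
\<close>

lemma psh_mult_compose_of_rel:
  assumes X: "X \<in> slice_ob Q" and Z: "Z \<in> slice_ob Q" and \<chi>: "\<chi> \<in> qrels Q (psh Q X) Z"
  shows "compose (und Z) (psh_mult Q X) (psh_of_rel (psh Q X) Z \<chi>) =
    psh_of_rel X Z (qrel_comp Q X (psh Q X) Z \<chi> (eval_rel Q X))"
proof -
  have "psh_mult Q X (psh_of_rel (psh Q X) Z \<chi> z) = psh_code (und X) (arr Z z)
      (\<lambda>x\<in>und X. qrel_comp Q X (psh Q X) Z \<chi> (eval_rel Q X) x z)"
    if z: "z \<in> und Z" for z
  proof -
    have "(\<lambda>p. Comp Q (arr X x) (psh_arr p) (arr Z z) (psh_val (psh_of_rel (psh Q X) Z \<chi> z) p) (psh_val p x)) ` psh_set Q X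
        = (\<lambda>p. Comp Q (arr X x) (arr (psh Q X) p) (arr Z z) (\<chi> p z) (eval_rel Q X x p)) ` psh_set Q X"
      if "x \<in> und X" for x
      using that z X by (intro image_cong refl) (simp add: psh_val_of_rel eval_rel_def)
    then show ?thesis
      using z psh_of_rel_in_psh_set[OF psh_slice_ob[OF X] Z \<chi> z]
      by (simp add: psh_mult_def qrel_comp_def cong: restrict_cong)
  qed
  then show ?thesis
    unfolding compose_def psh_of_rel_def[of X] by (intro restrict_ext) auto
qed

text \<open>
  Relational composition is Kleisli composition. Write \<open>p\<close> for the map that \<open>\<phi>\<close> names; then \<open>p\<^sub>!\<close>
  composes with \<open>p\<^sup>\<circ>\<close>, the multiplication composes with evaluation \<open>\<epsilon>\<close>, and
  \<open>(\<psi> \<circ> p\<^sup>\<circ>) \<circ> \<epsilon> = \<psi> \<circ> (p\<^sup>\<circ> \<circ> \<epsilon>) = \<psi> \<circ> \<phi>\<close>.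
\<close>

lemma kleisli_compose_of_rel:
  assumes ob: "X \<in> slice_ob Q" "Y \<in> slice_ob Q" "Z \<in> slice_ob Q"
    and \<phi>: "\<phi> \<in> qrels Q X Y" and \<psi>: "\<psi> \<in> qrels Q Y Z"
  shows "compose (und Z) (psh_mult Q X)
      (compose (und Z) (psh_map Q Y (psh Q X) (psh_of_rel X Y \<phi>)) (psh_of_rel Y Z \<psi>)) =
    psh_of_rel X Z (qrel_comp Q X Y Z \<psi> \<phi>)"
proof -
  let ?p = "psh_of_rel X Y \<phi>"
  have p: "?p \<in> slice_hom Y (psh Q X)"
    by (rule psh_of_rel_slice_hom[OF ob(1,2) \<phi>])
  have p': "cograph Q Y (psh Q X) ?p \<in> qrels Q (psh Q X) Y"
    using ob p by (intro cograph_in_qrels) auto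
  have "compose (und Z) (psh_mult Q X) (compose (und Z) (psh_map Q Y (psh Q X) ?p) (psh_of_rel Y Z \<psi>)) =
      psh_of_rel X Z (qrel_comp Q X (psh Q X) Z
        (qrel_comp Q (psh Q X) Y Z \<psi> (cograph Q Y (psh Q X) ?p)) (eval_rel Q X))"
    using ob \<psi> p p' by (simp add: psh_map_compose_of_rel psh_mult_compose_of_rel qrel_comp_in_qrels)
  also have "\<dots> = psh_of_rel X Z (qrel_comp Q X Y Z \<psi>
        (qrel_comp Q X (psh Q X) Y (cograph Q Y (psh Q X) ?p) (eval_rel Q X)))"
    using ob \<psi> p' by (simp add: qrel_comp_assoc eval_rel_in_qrels)
  finally show ?thesis
    by (simp add: cograph_of_rel_comp_eval_rel[OF ob(1,2) \<phi>])
qed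

end


section \<open>The lifted monad\<close>

locale lifted_monad = quantaloid Q for Q :: "'v::grothendieck_universe quantaloid" +
  fixes T :: "'v monad" and \<zeta> :: "'v \<Rightarrow> 'v"
  assumes set_monad: "set_monad T" and algebra: "monad_algebra T (Ob Q) \<zeta>"
begin

abbreviation L :: "'v ob \<Rightarrow> 'v ob" where "L \<equiv> lift_ob T Q \<zeta>"

lemmas set_monadD =
  set_monad[unfolded set_monad_def, THEN conjunct1]
  set_monad[unfolded set_monad_def, THEN conjunct2, THEN conjunct1, rule_format]
  set_monad[unfolded set_monad_def, THEN conjunct2, THEN conjunct2, THEN conjunct1, rule_format]
  set_monad[unfolded set_monad_def, THEN conjunct2, THEN conjunct2, THEN conjunct2, THEN conjunct1,
    rule_format, OF conjI]
  set_monad[unfolded set_monad_def, THEN conjunct2, THEN conjunct2, THEN conjunct2, THEN conjunct2,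
    THEN conjunct1, rule_format, OF conjI]

lemmas monad_functorD = set_monadD(1)[unfolded is_functor_def set_cat_def, simplified]

lemma TOb_small: "small X \<Longrightarrow> small (TOb T X)"
  using monad_functorD by simp

lemma TMap_closed: "\<lbrakk>small X; small Y; f \<in> X \<rightarrow>\<^sub>E Y\<rbrakk> \<Longrightarrow> TMap T X Y f \<in> TOb T X \<rightarrow>\<^sub>E TOb T Y"
  using monad_functorD by simp

lemma TMap_identity: "\<lbrakk>small X; t \<in> TOb T X\<rbrakk> \<Longrightarrow> TMap T X X (\<lambda>x\<in>X. x) t = t"
  using monad_functorD by simp

lemma TMap_compose:
  assumes "small X" "small Y" "small Z" "f \<in> X \<rightarrow>\<^sub>E Y" "g \<in> Y \<rightarrow>\<^sub>E Z" "t \<in> TOb T X"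
  shows "TMap T X Z (compose X g f) t = TMap T Y Z g (TMap T X Y f t)"
proof -
  have "TMap T X Z (compose X g f) = compose (TOb T X) (TMap T Y Z g) (TMap T X Y f)"
    using monad_functorD assms(1-5) by simp
  then show ?thesis using assms(6) by (simp add: compose_eq)
qed

lemma munit_closed: "small X \<Longrightarrow> munit T X \<in> X \<rightarrow>\<^sub>E TOb T X"
  by (rule set_monadD(2))

lemma mmult_closed: "small X \<Longrightarrow> mmult T X \<in> TOb T (TOb T X) \<rightarrow>\<^sub>E TOb T X"
  by (rule set_monadD(3))

lemma munit_natural:
  assumes "small X" "small Y" "f \<in> X \<rightarrow>\<^sub>E Y" "x \<in> X"
  shows "TMap T X Y f (munit T X x) = munit T Y (f x)"
  using fun_cong[OF set_monadD(4)[OF assms(1-3)], of x] assms(4) by (simp add: compose_eq)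

lemma mmult_natural:
  assumes "small X" "small Y" "f \<in> X \<rightarrow>\<^sub>E Y" "t \<in> TOb T (TOb T X)"
  shows "TMap T X Y f (mmult T X t) = mmult T Y (TMap T (TOb T X) (TOb T Y) (TMap T X Y f) t)"
  using fun_cong[OF set_monadD(5)[OF assms(1-3)], of t] assms(4) by (simp add: compose_eq)

lemma Ob_small: "small (Ob Q)"
  using algebra by (simp add: monad_algebra_def)

lemma algebra_closed: "\<zeta> \<in> TOb T (Ob Q) \<rightarrow>\<^sub>E Ob Q"
  using algebra by (simp add: monad_algebra_def)

lemma algebra_munit:
  assumes "s \<in> Ob Q"
  shows "\<zeta> (munit T (Ob Q) s) = s"
proof -
  have "compose (Ob Q) \<zeta> (munit T (Ob Q)) = (\<lambda>a\<in>Ob Q. a)"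
    using algebra by (simp add: monad_algebra_def)
  from fun_cong[OF this, of s] show ?thesis using assms by (simp add: compose_eq)
qed

lemma algebra_mmult:
  assumes "t \<in> TOb T (TOb T (Ob Q))"
  shows "\<zeta> (mmult T (Ob Q) t) = \<zeta> (TMap T (TOb T (Ob Q)) (Ob Q) \<zeta> t)"
proof -
  have "compose (TOb T (TOb T (Ob Q))) \<zeta> (TMap T (TOb T (Ob Q)) (Ob Q) \<zeta>) =
      compose (TOb T (TOb T (Ob Q))) \<zeta> (mmult T (Ob Q))"
    using algebra by (simp add: monad_algebra_def)
  from fun_cong[OF this, of t] show ?thesis using assms by (simp add: compose_eq)
qed

lemma und_lift [simp]: "und (L X) = TOb T (und X)"
  by (simp add: lift_ob_def)

lemma arr_lift: "t \<in> TOb T (und X) \<Longrightarrow> arr (L X) t = \<zeta> (TMap T (und X) (Ob Q) (arr X) t)"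
  by (simp add: lift_ob_def compose_eq)

lemma arr_extensional: "X \<in> slice_ob Q \<Longrightarrow> arr X \<in> und X \<rightarrow>\<^sub>E Ob Q"
  by (simp add: slice_ob_def)

lemma lift_slice_ob [simp]:
  assumes X: "X \<in> slice_ob Q"
  shows "L X \<in> slice_ob Q"
proof -
  have "arr (L X) \<in> TOb T (und X) \<rightarrow>\<^sub>E Ob Q"
    using TMap_closed[OF slice_ob_small[OF X] Ob_small arr_extensional[OF X]] algebra_closed
    by (auto simp: lift_ob_def compose_def)
  then show ?thesis
    using TOb_small[OF slice_ob_small[OF X]] by (simp add: slice_ob_def)
qed

lemma slice_hom_extensional: "f \<in> slice_hom X Y \<Longrightarrow> f \<in> und X \<rightarrow>\<^sub>E und Y"
  by (simp add: slice_hom_def)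

lemma lift_slice_hom:
  assumes X: "X \<in> slice_ob Q" and Y: "Y \<in> slice_ob Q" and f: "f \<in> slice_hom X Y"
  shows "Tm T X Y f \<in> slice_hom (L X) (L Y)"
proof -
  note small = slice_ob_small[OF X] slice_ob_small[OF Y] Ob_small
  note f' = slice_hom_extensional[OF f]
  have arr: "compose (und X) (arr Y) f = arr X"
    using slice_homD(2)[OF f] arr_extensional[OF X]
    by (auto intro!: ext simp: compose_def restrict_def PiE_def extensional_def)
  have Tf: "Tm T X Y f \<in> TOb T (und X) \<rightarrow>\<^sub>E TOb T (und Y)"
    by (rule TMap_closed[OF small(1,2) f'])
  moreover have "arr (L Y) (Tm T X Y f t) = arr (L X) t" if t: "t \<in> TOb T (und X)" for t
  proof -
    have "Tm T X Y f t \<in> TOb T (und Y)"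
      using Tf t by auto
    then show ?thesis
      using TMap_compose[OF small f' arr_extensional[OF Y] t] t by (simp add: arr arr_lift)
  qed
  ultimately show ?thesis
    by (simp add: slice_hom_def)
qed

text \<open>
  The unit law of the algebra \<open>\<zeta>\<close> makes the unit of the monad preserve arrays.
\<close>

lemma munit_slice_hom:
  assumes X: "X \<in> slice_ob Q"
  shows "munit T (und X) \<in> slice_hom X (L X)"
proof -
  note e = munit_closed[OF slice_ob_small[OF X]]
  have "arr (L X) (munit T (und X) x) = arr X x" if x: "x \<in> und X" for x
  proof -
    have "munit T (und X) x \<in> TOb T (und X)" using e x by auto
    then show ?thesis
      using munit_natural[OF slice_ob_small[OF X] Ob_small arr_extensional[OF X] x] X x
      by (simp add: arr_lift algebra_munit)
  qed
  then show ?thesis using e by (simp add: slice_hom_def)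
qed

text \<open>
  Preservation of arrays by the multiplication is the associativity law of the algebra \<open>\<zeta>\<close>, moved
  from the object set to \<open>X\<close> by naturality along the array map.
\<close>

lemma mmult_slice_hom:
  assumes X: "X \<in> slice_ob Q"
  shows "mmult T (und X) \<in> slice_hom (L (L X)) (L X)"
proof -
  note small = slice_ob_small[OF X]
  note m = mmult_closed[OF small]
  note a = arr_extensional[OF X]
  note Ta = TMap_closed[OF small Ob_small a]
  have "arr (L X) (mmult T (und X) s) = arr (L (L X)) s" if s: "s \<in> TOb T (TOb T (und X))" for s
  proof -
    let ?TT = "TMap T (TOb T (und X)) (TOb T (Ob Q)) (TMap T (und X) (Ob Q) (arr X))"
    have ms: "mmult T (und X) s \<in> TOb T (und X)" using m s by auto
    have TTs: "?TT s \<in> TOb T (TOb T (Ob Q))"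
      using TMap_closed[OF TOb_small[OF small] TOb_small[OF Ob_small] Ta] s by auto
    have "arr (L X) (mmult T (und X) s) = \<zeta> (mmult T (Ob Q) (?TT s))"
      using ms s by (simp add: arr_lift mmult_natural[OF small Ob_small a])
    also have "\<dots> = \<zeta> (TMap T (TOb T (Ob Q)) (Ob Q) \<zeta> (?TT s))"
      by (rule algebra_mmult[OF TTs])
    also have "\<dots> = \<zeta> (TMap T (TOb T (und X)) (Ob Q) (compose (TOb T (und X)) \<zeta> (TMap T (und X) (Ob Q) (arr X))) s)"
      using TMap_compose[OF TOb_small[OF small] TOb_small[OF Ob_small] Ob_small Ta algebra_closed s]
      by simp
    also have "\<dots> = arr (L (L X)) s"
      using s by (simp add: arr_lift) (simp add: lift_ob_def)
    finally show ?thesis .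
  qed
  then show ?thesis using m by (simp add: slice_hom_def)
qed

end

section \<open>Functors that do not change the morphisms\<close>

text \<open>
  If the morphisms and operations agree along a bijection of objects, the axioms of a category pass to
  the other side. They are therefore checked only for relations, where they are pointwise
  inequalities, and not for algebras.
\<close>

lemma is_cat_isomorphismI:
  assumes C: "is_category C" and bij: "bij_betw Fo (Obj C) (Obj D)"
    and Mor: "\<And>X Y. X \<in> Obj C \<Longrightarrow> Y \<in> Obj C \<Longrightarrow> Mor D (Fo X) (Fo Y) = Mor C X Y"
    and Idt: "\<And>X. X \<in> Obj C \<Longrightarrow> Idt D (Fo X) = Idt C X"
    and Cps: "\<And>X Y Z f g. X \<in> Obj C \<Longrightarrow> Y \<in> Obj C \<Longrightarrow> Z \<in> Obj C \<Longrightarrow>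
      Cps D (Fo X) (Fo Y) (Fo Z) g f = Cps C X Y Z g f"
  shows "is_cat_isomorphism C D Fo (\<lambda>_ _ f. f)"
proof -
  have Obj: "Obj D = Fo ` Obj C"
    using bij by (simp add: bij_betw_def)
  have "is_category D \<longleftrightarrow> is_category C"
    unfolding is_category_def Obj by (simp add: Mor Idt Cps cong: ball_cong)
  then have "is_functor C D Fo (\<lambda>_ _ f. f)"
    unfolding is_functor_def using C by (simp add: Obj Mor Idt Cps)
  then show ?thesis
    unfolding is_cat_isomorphism_def using bij by (simp add: Mor bij_betw_def)
qed

text \<open>
  Along isomorphisms that fix the morphisms, a functor that fixes the morphisms is moved to the
  categories on the other side.
\<close>

lemma is_functor_transport:
  assumes G: "is_functor C D G (\<lambda>_ _ f. f)"
    and I: "is_cat_isomorphism C C' I (\<lambda>_ _ f. f)" and J: "is_cat_isomorphism D D' J (\<lambda>_ _ f. f)"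
    and sq: "\<And>A. A \<in> Obj C \<Longrightarrow> H (I A) = J (G A)"
  shows "is_functor C' D' H (\<lambda>_ _ f. f)"
proof -
  have FI: "is_functor C C' I (\<lambda>_ _ f. f)" and FJ: "is_functor D D' J (\<lambda>_ _ f. f)"
    using I J by (simp_all add: is_cat_isomorphism_def)
  have Obj: "Obj C' = I ` Obj C"
    using I by (simp add: is_cat_isomorphism_def bij_betw_def)
  have MorI: "Mor C' (I A) (I B) = Mor C A B" if "A \<in> Obj C" "B \<in> Obj C" for A B
    using I that by (simp add: is_cat_isomorphism_def bij_betw_def)
  have GO: "G A \<in> Obj D" if "A \<in> Obj C" for A
    using G that by (simp add: is_functor_def)
  have JO: "J A \<in> Obj D'" if "A \<in> Obj D" for A
    using FJ that by (simp add: is_functor_def)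
  have Mor: "f \<in> Mor D' (J (G A)) (J (G B))" if "A \<in> Obj C" "B \<in> Obj C" "f \<in> Mor C A B" for A B f
    using G FJ that by (simp add: is_functor_def)
  have Idt: "Idt C' (I A) = Idt D' (J (G A))" if "A \<in> Obj C" for A
  proof -
    have "Idt C' (I A) = Idt C A" "Idt C A = Idt D (G A)" "Idt D (G A) = Idt D' (J (G A))"
      using FI FJ G that GO[OF that] unfolding is_functor_def by simp_all
    then show ?thesis by simp
  qed
  have Cps: "Cps C' (I A) (I B) (I E) g f = Cps D' (J (G A)) (J (G B)) (J (G E)) g f"
    if o: "A \<in> Obj C" "B \<in> Obj C" "E \<in> Obj C" and m: "f \<in> Mor C A B" "g \<in> Mor C B E" for A B E f g
  proof -
    have "Cps C A B E g f = Cps C' (I A) (I B) (I E) g f"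
      using FI o m unfolding is_functor_def by simp
    moreover have "Cps C A B E g f = Cps D (G A) (G B) (G E) g f"
      using G o m unfolding is_functor_def by simp
    moreover have "f \<in> Mor D (G A) (G B)" "g \<in> Mor D (G B) (G E)"
      using G o m unfolding is_functor_def by simp_all
    then have "Cps D (G A) (G B) (G E) g f = Cps D' (J (G A)) (J (G B)) (J (G E)) g f"
      using FJ GO[OF o(1)] GO[OF o(2)] GO[OF o(3)] unfolding is_functor_def by simp
    ultimately show ?thesis by simp
  qed
  have cats: "is_category C'" "is_category D'"
    using FI FJ by (simp_all add: is_functor_def)
  show ?thesis
    unfolding is_functor_def Obj
    by (intro conjI ballI cats) (auto simp: sq MorI GO JO Mor Idt Cps)
qed

section \<open>Lax algebras as relations and as presheaf-valued maps\<close>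

locale law_extension = lifted_monad Q T \<zeta>
  for Q :: "'v::grothendieck_universe quantaloid" and T \<zeta> +
  fixes E :: "'v ob \<Rightarrow> 'v ob \<Rightarrow> 'v qrel \<Rightarrow> 'v qrel" and \<Lambda> :: "'v ob \<Rightarrow> 'v \<Rightarrow> 'v"
  assumes extension: "lax_extension T Q \<zeta> E"
    and correspond: "law_extension_correspond T Q \<zeta> E \<Lambda>"
begin

abbreviation Cat where "Cat \<equiv> tqcat T Q \<zeta> E"
abbreviation Alg where "Alg \<equiv> alg_cat T Q \<zeta> \<Lambda>"

lemma extension_in_qrels [simp]:
  "\<lbrakk>X \<in> slice_ob Q; Y \<in> slice_ob Q; \<phi> \<in> qrels Q X Y\<rbrakk> \<Longrightarrow> E X Y \<phi> \<in> qrels Q (L X) (L Y)"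
  by (rule extension[unfolded lax_extension_def Let_def, THEN conjunct1, rule_format])

lemma law_eq:
  "X \<in> slice_ob Q \<Longrightarrow> \<Lambda> X = psh_of_rel (L X) (L (psh Q X)) (E X (psh Q X) (eval_rel Q X))"
  by (rule correspond[unfolded law_extension_correspond_def Let_def, THEN conjunct1, rule_format])

lemma psh_of_rel_extension:
  "\<lbrakk>X \<in> slice_ob Q; Y \<in> slice_ob Q; \<phi> \<in> qrels Q X Y\<rbrakk> \<Longrightarrow>
    psh_of_rel (L X) (L Y) (E X Y \<phi>) =
    compose (und (L Y)) (\<Lambda> X) (Tm T Y (psh Q X) (psh_of_rel X Y \<phi>))"
  by (rule correspond[unfolded law_extension_correspond_def Let_def, THEN conjunct2, rule_format])

lemma Obj_Cat_iff:
  "(X, \<alpha>) \<in> Obj Cat \<longleftrightarrow> X \<in> slice_ob Q \<and> \<alpha> \<in> qrels Q X (L X) \<and>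
    qrel_le Q X X (qrel_id Q X) (qrel_comp Q X (L X) X (cograph Q X (L X) (munit T (und X))) \<alpha>) \<and>
    qrel_le Q X (L (L X)) (qrel_comp Q X (L X) (L (L X)) (E X (L X) \<alpha>) \<alpha>)
      (qrel_comp Q X (L X) (L (L X)) (cograph Q (L (L X)) (L X) (mmult T (und X))) \<alpha>)"
  by (simp add: tqcat_def Let_def)

text \<open>
  Without the suprema, the axioms only involve single entries of \<open>\<alpha>\<close>, to which a lax homomorphism
  can be applied even though it need not preserve suprema.
\<close>

lemma Obj_Cat_pointwise_iff:
  "(X, \<alpha>) \<in> Obj Cat \<longleftrightarrow> X \<in> slice_ob Q \<and> \<alpha> \<in> qrels Q X (L X) \<and>
    (\<forall>x\<in>und X. qle Q (arr X x) (arr X x) (One Q (arr X x)) (\<alpha> x (munit T (und X) x))) \<and>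
    (\<forall>x\<in>und X. \<forall>t\<in>und (L X). \<forall>s\<in>und (L (L X)). qle Q (arr X x) (arr (L (L X)) s)
       (Comp Q (arr X x) (arr (L X) t) (arr (L (L X)) s) (E X (L X) \<alpha> t s) (\<alpha> x t))
       (\<alpha> x (mmult T (und X) s)))"
proof (cases "X \<in> slice_ob Q \<and> \<alpha> \<in> qrels Q X (L X)")
  case True
  then have X: "X \<in> slice_ob Q" and \<alpha>: "\<alpha> \<in> qrels Q X (L X)" by auto
  note LX = lift_slice_ob[OF X] and LLX = lift_slice_ob[OF lift_slice_ob[OF X]]
  note e = munit_slice_hom[OF X] and m = mmult_slice_hom[OF X]
  have e': "qrel_comp Q X (L X) X (cograph Q X (L X) (munit T (und X))) \<alpha> \<in> qrels Q X X"
    using X LX \<alpha> e by (intro qrel_comp_in_qrels cograph_in_qrels)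
  have m': "qrel_comp Q X (L X) (L (L X)) (cograph Q (L (L X)) (L X) (mmult T (und X))) \<alpha>
      \<in> qrels Q X (L (L X))"
    using X LX LLX \<alpha> m by (intro qrel_comp_in_qrels cograph_in_qrels)
  show ?thesis
    unfolding Obj_Cat_iff qrel_id_le_iff[OF X e']
      qrel_comp_le_iff[OF X LX LLX \<alpha> extension_in_qrels[OF X LX \<alpha>] m']
    using cograph_comp_apply[OF X LX X \<alpha> e] cograph_comp_apply[OF X LX LLX \<alpha> m]
    by (simp cong: ball_cong)
qed (auto simp: Obj_Cat_iff)

lemma Mor_Cat:
  "Mor Cat (X, \<alpha>) (Y, \<beta>) = {f \<in> slice_hom X Y.
    qrel_le Q Y (L X) (qrel_comp Q Y X (L X) \<alpha> (cograph Q X Y f))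
      (qrel_comp Q Y (L Y) (L X) (cograph Q (L X) (L Y) (Tm T X Y f)) \<beta>)}"
  by (simp add: tqcat_def Let_def)

lemma Mor_Cat_pointwise_iff:
  assumes X: "X \<in> slice_ob Q" and Y: "Y \<in> slice_ob Q"
    and \<alpha>: "\<alpha> \<in> qrels Q X (L X)" and \<beta>: "\<beta> \<in> qrels Q Y (L Y)"
  shows "f \<in> Mor Cat (X, \<alpha>) (Y, \<beta>) \<longleftrightarrow> f \<in> slice_hom X Y \<and>
    (\<forall>x\<in>und X. \<forall>t\<in>und (L X). qle Q (arr X x) (arr (L X) t) (\<alpha> x t) (\<beta> (f x) (Tm T X Y f t)))"
proof (cases "f \<in> slice_hom X Y")
  case True
  note LX = lift_slice_ob[OF X] and LY = lift_slice_ob[OF Y]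
  note Tf = lift_slice_hom[OF X Y True]
  have "qrel_comp Q Y (L Y) (L X) (cograph Q (L X) (L Y) (Tm T X Y f)) \<beta> \<in> qrels Q Y (L X)"
    using Y LX LY \<beta> Tf by (intro qrel_comp_in_qrels cograph_in_qrels)
  then show ?thesis
    using True slice_homD(1)[OF True]
    by (simp add: Mor_Cat comp_cograph_le_iff[OF X Y LX \<alpha>] cograph_comp_apply[OF Y LY LX \<beta> Tf] del: und_lift cong: ball_cong)
qed (simp add: Mor_Cat)

lemma Idt_Cat: "Idt Cat A = (\<lambda>x\<in>und (fst A). x)"
  by (cases A) (simp add: tqcat_def Let_def)

lemma Cps_Cat: "Cps Cat A B C g f = compose (und (fst A)) g f"
  by (cases A; cases B; cases C) (simp add: tqcat_def Let_def)

lemma Idt_Cat_in_Mor: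
  assumes "A \<in> Obj Cat"
  shows "Idt Cat A \<in> Mor Cat A A"
proof -
  obtain X \<alpha> where A: "A = (X, \<alpha>)" by (cases A)
  have X: "X \<in> slice_ob Q" and \<alpha>: "\<alpha> \<in> qrels Q X (L X)"
    using assms by (simp_all add: A Obj_Cat_iff)
  show ?thesis
    using qrels_closed[OF \<alpha>] X
    by (auto simp: A Idt_Cat Mor_Cat_pointwise_iff[OF X X \<alpha> \<alpha>] identity_slice_hom TMap_identity
        slice_ob_small intro!: qle_refl arr_closed)
qed

lemma Cps_Cat_in_Mor:
  assumes objects: "A \<in> Obj Cat" "B \<in> Obj Cat" "C \<in> Obj Cat"
    and f: "f \<in> Mor Cat A B" and g: "g \<in> Mor Cat B C"
  shows "Cps Cat A B C g f \<in> Mor Cat A C"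
proof -
  obtain X \<alpha> Y \<beta> Z \<gamma> where A: "A = (X, \<alpha>)" "B = (Y, \<beta>)" "C = (Z, \<gamma>)"
    by (cases A; cases B; cases C)
  have ob: "X \<in> slice_ob Q" "Y \<in> slice_ob Q" "Z \<in> slice_ob Q"
    and rel: "\<alpha> \<in> qrels Q X (L X)" "\<beta> \<in> qrels Q Y (L Y)" "\<gamma> \<in> qrels Q Z (L Z)"
    using objects by (simp_all add: A Obj_Cat_iff)
  have f': "f \<in> slice_hom X Y" and fle: "\<And>x t. x \<in> und X \<Longrightarrow> t \<in> und (L X) \<Longrightarrow>
      qle Q (arr X x) (arr (L X) t) (\<alpha> x t) (\<beta> (f x) (Tm T X Y f t))"
    using f unfolding A Mor_Cat_pointwise_iff[OF ob(1,2) rel(1,2)] by auto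
  have g': "g \<in> slice_hom Y Z" and gle: "\<And>y t. y \<in> und Y \<Longrightarrow> t \<in> und (L Y) \<Longrightarrow>
      qle Q (arr Y y) (arr (L Y) t) (\<beta> y t) (\<gamma> (g y) (Tm T Y Z g t))"
    using g unfolding A Mor_Cat_pointwise_iff[OF ob(2,3) rel(2,3)] by auto
  note Tf = lift_slice_hom[OF ob(1,2) f'] and Tg = lift_slice_hom[OF ob(2,3) g']
  have gf: "compose (und X) g f \<in> slice_hom X Z"
    using slice_homD[OF f'] slice_homD[OF g'] by (auto simp: slice_hom_def compose_def)
  moreover have "qle Q (arr X x) (arr (L X) t) (\<alpha> x t)
      (\<gamma> (compose (und X) g f x) (Tm T X Z (compose (und X) g f) t))"
    if x: "x \<in> und X" and t: "t \<in> und (L X)" for x t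
  proof -
    have fx: "f x \<in> und Y" "arr Y (f x) = arr X x"
      using slice_homD[OF f' x] by auto
    have ft: "Tm T X Y f t \<in> und (L Y)" "arr (L Y) (Tm T X Y f t) = arr (L X) t"
      using slice_homD[OF Tf t] by auto
    have gx: "g (f x) \<in> und Z" "arr Z (g (f x)) = arr X x"
      using slice_homD[OF g' fx(1)] fx(2) by auto
    have gt: "Tm T Y Z g (Tm T X Y f t) \<in> und (L Z)" "arr (L Z) (Tm T Y Z g (Tm T X Y f t)) = arr (L X) t"
      using slice_homD[OF Tg ft(1)] ft(2) by auto
    have "Tm T X Z (compose (und X) g f) t = Tm T Y Z g (Tm T X Y f t)"
      using t ob f' g' by (intro TMap_compose slice_ob_small slice_hom_extensional) auto
    moreover have "qle Q (arr X x) (arr (L X) t) (\<alpha> x t) (\<gamma> (g (f x)) (Tm T Y Z g (Tm T X Y f t)))"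
    proof (rule qle_trans)
      show "qle Q (arr X x) (arr (L X) t) (\<alpha> x t) (\<beta> (f x) (Tm T X Y f t))"
        by (rule fle[OF x t])
      show "qle Q (arr X x) (arr (L X) t) (\<beta> (f x) (Tm T X Y f t)) (\<gamma> (g (f x)) (Tm T Y Z g (Tm T X Y f t)))"
        using gle[OF fx(1) ft(1)] fx(2) ft(2) by simp
      show "arr X x \<in> Ob Q" "arr (L X) t \<in> Ob Q"
        using ob x t by (auto intro!: arr_closed simp del: und_lift)
      show "\<alpha> x t \<in> carrier (Hom Q (arr X x) (arr (L X) t))"
        by (rule qrels_closed[OF rel(1) x t])
      show "\<beta> (f x) (Tm T X Y f t) \<in> carrier (Hom Q (arr X x) (arr (L X) t))"
        using qrels_closed[OF rel(2) fx(1) ft(1)] fx(2) ft(2) by simp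
      show "\<gamma> (g (f x)) (Tm T Y Z g (Tm T X Y f t)) \<in> carrier (Hom Q (arr X x) (arr (L X) t))"
        using qrels_closed[OF rel(3) gx(1) gt(1)] gx(2) gt(2) by simp
    qed
    ultimately show ?thesis
      using x by (simp add: compose_eq)
  qed
  ultimately show ?thesis
    by (simp add: A Cps_Cat Mor_Cat_pointwise_iff[OF ob(1,3) rel(1,3)])
qed

lemma is_category_Cat: "is_category Cat"
proof -
  have into: "f \<in> und (fst A) \<rightarrow>\<^sub>E und (fst B)" if "f \<in> Mor Cat A B" for A B f
    using that by (cases A; cases B) (simp add: Mor_Cat slice_hom_def)
  have unit: "Cps Cat A A B f (Idt Cat A) = f" "Cps Cat A B B (Idt Cat B) f = f"
    if "f \<in> Mor Cat A B" for A B f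
    using into[OF that] unfolding Cps_Cat Idt_Cat
    by (auto intro!: extensionalityI[of _ "und (fst A)"] simp: compose_eq PiE_iff)
  have assoc: "Cps Cat A B D (Cps Cat B C D h g) f = Cps Cat A C D h (Cps Cat A B C g f)"
    if "f \<in> Mor Cat A B" for A B C D f g h
    unfolding Cps_Cat by (rule compose_assoc[symmetric]) (use into[OF that] in auto)
  show ?thesis
    unfolding is_category_def
    by (intro conjI ballI Idt_Cat_in_Mor; (rule Cps_Cat_in_Mor unit assoc; assumption)?)
qed

text \<open>
  Both presentations of a lax algebra consist of the same inequalities: reading relations as maps
  into presheaves turns relational composition into Kleisli composition, and the extension into the
  distributive law.
\<close>

lemma Obj_Alg_of_rel_iff:
  assumes X: "X \<in> slice_ob Q" and \<alpha>: "\<alpha> \<in> qrels Q X (L X)"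
  shows "(X, psh_of_rel X (L X) \<alpha>) \<in> Obj Alg \<longleftrightarrow> (X, \<alpha>) \<in> Obj Cat"
proof -
  note LX = lift_slice_ob[OF X] and LLX = lift_slice_ob[OF lift_slice_ob[OF X]]
  let ?p = "psh_of_rel X (L X) \<alpha>"
  have "compose (und X) ?p (munit T (und X)) =
      psh_of_rel X X (qrel_comp Q X (L X) X (cograph Q X (L X) (munit T (und X))) \<alpha>)"
    using X LX \<alpha> by (intro psh_of_rel_precompose munit_slice_hom)
  moreover have "compose (und (L (L X))) ?p (mmult T (und X)) =
      psh_of_rel X (L (L X)) (qrel_comp Q X (L X) (L (L X)) (cograph Q (L (L X)) (L X) (mmult T (und X))) \<alpha>)"
    using X LX LLX \<alpha> by (intro psh_of_rel_precompose mmult_slice_hom)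
  moreover have "compose (und (L (L X))) (psh_mult Q X)
      (compose (und (L (L X))) (psh_map Q (L X) (psh Q X) ?p)
        (compose (und (L (L X))) (\<Lambda> X) (Tm T (L X) (psh Q X) ?p))) =
      psh_of_rel X (L (L X)) (qrel_comp Q X (L X) (L (L X)) (E X (L X) \<alpha>) \<alpha>)"
    unfolding psh_of_rel_extension[OF X LX \<alpha>, symmetric]
    using X LX LLX \<alpha> by (intro kleisli_compose_of_rel extension_in_qrels)
  ultimately show ?thesis
    using X \<alpha> psh_of_rel_slice_hom[OF X LX \<alpha>]
    unfolding Obj_Cat_iff alg_cat_def Let_def
    by (simp add: psh_unit_eq_of_rel psh_le_of_rel_iff[OF X] del: und_lift und_psh)
qed

lemma Mor_Alg_of_rel:
  assumes X: "X \<in> slice_ob Q" and Y: "Y \<in> slice_ob Q"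
    and \<alpha>: "\<alpha> \<in> qrels Q X (L X)" and \<beta>: "\<beta> \<in> qrels Q Y (L Y)"
  shows "Mor Alg (X, psh_of_rel X (L X) \<alpha>) (Y, psh_of_rel Y (L Y) \<beta>) = Mor Cat (X, \<alpha>) (Y, \<beta>)"
proof -
  note LX = lift_slice_ob[OF X] and LY = lift_slice_ob[OF Y]
  have "psh_le Q Y (und (L X)) (compose (und (L X)) (psh_map Q X Y f) (psh_of_rel X (L X) \<alpha>))
        (compose (und (L X)) (psh_of_rel Y (L Y) \<beta>) (Tm T X Y f)) \<longleftrightarrow>
      qrel_le Q Y (L X) (qrel_comp Q Y X (L X) \<alpha> (cograph Q X Y f))
        (qrel_comp Q Y (L Y) (L X) (cograph Q (L X) (L Y) (Tm T X Y f)) \<beta>)"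
    if f: "f \<in> slice_hom X Y" for f
    unfolding psh_map_compose_of_rel[OF X Y LX \<alpha> f]
      psh_of_rel_precompose[OF Y LY LX \<beta> lift_slice_hom[OF X Y f]]
    by (rule psh_le_of_rel_iff[OF Y])
  then show ?thesis
    unfolding Mor_Cat alg_cat_def Let_def by (auto simp del: und_lift)
qed

lemma cat_to_alg_isomorphism: "is_cat_isomorphism Cat Alg (cat_to_alg T Q \<zeta>) (\<lambda>_ _ f. f)"
proof (rule is_cat_isomorphismI)
  have eq: "cat_to_alg T Q \<zeta> (X, \<alpha>) = (X, psh_of_rel X (L X) \<alpha>)" for X \<alpha>
    by (simp add: cat_to_alg_def)
  have bij: "bij_betw (psh_of_rel X (L X)) (qrels Q X (L X)) (slice_hom (L X) (psh Q X))"
    if "X \<in> slice_ob Q" for X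
    by (rule psh_of_rel_bij_betw[OF that lift_slice_ob[OF that]])
  show "bij_betw (cat_to_alg T Q \<zeta>) (Obj Cat) (Obj Alg)"
  proof (rule bij_betw_imageI)
    show "inj_on (cat_to_alg T Q \<zeta>) (Obj Cat)"
    proof (rule inj_onI, clarify)
      fix X \<alpha> Y \<beta>
      assume o: "(X, \<alpha>) \<in> Obj Cat" "(Y, \<beta>) \<in> Obj Cat"
        and e: "cat_to_alg T Q \<zeta> (X, \<alpha>) = cat_to_alg T Q \<zeta> (Y, \<beta>)"
      have "X = Y" "psh_of_rel X (L X) \<alpha> = psh_of_rel X (L X) \<beta>"
        using e by (auto simp: eq)
      then show "X = Y \<and> \<alpha> = \<beta>"
        using o bij[of X] by (auto simp: Obj_Cat_iff bij_betw_def dest: inj_onD)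
    qed
    show "cat_to_alg T Q \<zeta> ` Obj Cat = Obj Alg"
    proof (intro equalityI subsetI)
      fix A assume "A \<in> cat_to_alg T Q \<zeta> ` Obj Cat"
      then obtain X \<alpha> where o: "(X, \<alpha>) \<in> Obj Cat" and A: "A = (X, psh_of_rel X (L X) \<alpha>)"
        by (auto simp: eq)
      then show "A \<in> Obj Alg"
        using Obj_Alg_of_rel_iff[of X \<alpha>] by (simp add: Obj_Cat_iff)
    next
      fix A assume A: "A \<in> Obj Alg"
      obtain X p where Xp: "A = (X, p)" by (cases A)
      have X: "X \<in> slice_ob Q" and p: "p \<in> slice_hom (L X) (psh Q X)"
        using A by (simp_all add: Xp alg_cat_def Let_def)
      obtain \<alpha> where \<alpha>: "\<alpha> \<in> qrels Q X (L X)" and p\<alpha>: "p = psh_of_rel X (L X) \<alpha>"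
        using bij[OF X] p by (auto simp: bij_betw_def)
      have "(X, \<alpha>) \<in> Obj Cat"
        using A Obj_Alg_of_rel_iff[OF X \<alpha>] by (simp add: Xp p\<alpha>)
      moreover have "A = cat_to_alg T Q \<zeta> (X, \<alpha>)"
        by (simp add: eq Xp p\<alpha>)
      ultimately show "A \<in> cat_to_alg T Q \<zeta> ` Obj Cat" by blast
    qed
  qed
  show "Mor Alg (cat_to_alg T Q \<zeta> A) (cat_to_alg T Q \<zeta> B) = Mor Cat A B"
    if "A \<in> Obj Cat" "B \<in> Obj Cat" for A B
    using that by (cases A; cases B) (simp add: eq Obj_Cat_iff Mor_Alg_of_rel)
  show "Idt Alg (cat_to_alg T Q \<zeta> A) = Idt Cat A" for A
    by (cases A) (simp add: eq Idt_Cat alg_cat_def Let_def)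
  show "Cps Alg (cat_to_alg T Q \<zeta> A) (cat_to_alg T Q \<zeta> B) (cat_to_alg T Q \<zeta> C) g f = Cps Cat A B C g f"
    for A B C f g
    by (cases A; cases B; cases C) (simp add: eq Cps_Cat alg_cat_def Let_def)
qed (rule is_category_Cat)

end


section \<open>Change of base along a lax homomorphism\<close>

locale base_change = Q: quantaloid Q + R: quantaloid R
  for Q R :: "'v::grothendieck_universe quantaloid" +
  fixes \<theta>\<^sub>0 :: "'v \<Rightarrow> 'v" and \<theta> :: "'v \<Rightarrow> 'v \<Rightarrow> 'v \<Rightarrow> 'v"
  assumes lax_hom: "lax_hom Q R \<theta>\<^sub>0 \<theta>"
begin

abbreviation B :: "'v ob \<Rightarrow> 'v ob" where "B \<equiv> base_ob \<theta>\<^sub>0"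

lemmas lax_homD =
  lax_hom[unfolded lax_hom_def, THEN conjunct1]
  lax_hom[unfolded lax_hom_def, THEN conjunct2, THEN conjunct1, rule_format]
  lax_hom[unfolded lax_hom_def, THEN conjunct2, THEN conjunct2, THEN conjunct1, rule_format]
  lax_hom[unfolded lax_hom_def, THEN conjunct2, THEN conjunct2, THEN conjunct2, rule_format]

lemma object_map_extensional: "\<theta>\<^sub>0 \<in> Ob Q \<rightarrow>\<^sub>E Ob R"
  by (rule lax_homD(1))

lemma object_map_closed [simp]: "s \<in> Ob Q \<Longrightarrow> \<theta>\<^sub>0 s \<in> Ob R"
  using object_map_extensional by auto

lemma hom_map_closed [simp]:
  "\<lbrakk>s \<in> Ob Q; t \<in> Ob Q; u \<in> carrier (Hom Q s t)\<rbrakk> \<Longrightarrow> \<theta> s t u \<in> carrier (Hom R (\<theta>\<^sub>0 s) (\<theta>\<^sub>0 t))"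
  using lax_homD(2) by auto

lemma hom_map_mono:
  "\<lbrakk>s \<in> Ob Q; t \<in> Ob Q; u \<in> carrier (Hom Q s t); v \<in> carrier (Hom Q s t); qle Q s t u v\<rbrakk>
    \<Longrightarrow> qle R (\<theta>\<^sub>0 s) (\<theta>\<^sub>0 t) (\<theta> s t u) (\<theta> s t v)"
  by (rule use_iso2[OF lax_homD(2)[THEN conjunct2]])

lemma One_le_hom_map: "t \<in> Ob Q \<Longrightarrow> qle R (\<theta>\<^sub>0 t) (\<theta>\<^sub>0 t) (One R (\<theta>\<^sub>0 t)) (\<theta> t t (One Q t))"
  by (rule lax_homD(3))

lemma Comp_le_hom_map:
  "\<lbrakk>r \<in> Ob Q; s \<in> Ob Q; t \<in> Ob Q; u \<in> carrier (Hom Q r s); v \<in> carrier (Hom Q s t)\<rbrakk>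
    \<Longrightarrow> qle R (\<theta>\<^sub>0 r) (\<theta>\<^sub>0 t)
      (Comp R (\<theta>\<^sub>0 r) (\<theta>\<^sub>0 s) (\<theta>\<^sub>0 t) (\<theta> s t v) (\<theta> r s u)) (\<theta> r t (Comp Q r s t v u))"
  by (rule lax_homD(4))

lemma und_base [simp]: "und (B X) = und X"
  by (simp add: base_ob_def)

lemma arr_base [simp]: "x \<in> und X \<Longrightarrow> arr (B X) x = \<theta>\<^sub>0 (arr X x)"
  by (simp add: base_ob_def compose_eq)

lemma base_slice_ob [simp]:
  assumes "X \<in> slice_ob Q"
  shows "B X \<in> slice_ob R"
proof -
  have "arr (B X) \<in> und X \<rightarrow>\<^sub>E Ob R"
    using Q.arr_closed[OF assms] by (auto simp: base_ob_def compose_def)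
  then show ?thesis
    using Q.slice_ob_small[OF assms] by (simp add: slice_ob_def)
qed

lemma base_slice_hom: "f \<in> slice_hom X Y \<Longrightarrow> f \<in> slice_hom (B X) (B Y)"
  using Q.slice_homD[of f X Y] by (simp add: slice_hom_def)

lemma base_rel_apply: "x \<in> und X \<Longrightarrow> y \<in> und Y \<Longrightarrow> base_rel \<theta> X Y \<phi> x y = \<theta> (arr X x) (arr Y y) (\<phi> x y)"
  by (simp add: base_rel_def)

lemma base_rel_in_qrels:
  assumes "X \<in> slice_ob Q" "Y \<in> slice_ob Q" "\<phi> \<in> qrels Q X Y"
  shows "base_rel \<theta> X Y \<phi> \<in> qrels R (B X) (B Y)"
  unfolding qrels_def base_rel_def und_base
  using assms by (intro restrict_PiE_iff[THEN iffD2] ballI) auto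

text \<open>
  Entrywise application of \<open>\<theta>\<close> to relations is postcomposition with \<open>\<theta>\<^sub>X\<close> of the maps that they name.
\<close>

lemma base_psh_compose_of_rel:
  assumes "X \<in> slice_ob Q" "Y \<in> slice_ob Q" "\<phi> \<in> qrels Q X Y"
  shows "compose (und Y) (base_psh Q \<theta>\<^sub>0 \<theta> X) (psh_of_rel X Y \<phi>) =
    psh_of_rel (B X) (B Y) (base_rel \<theta> X Y \<phi>)"
proof -
  have "base_psh Q \<theta>\<^sub>0 \<theta> X (psh_of_rel X Y \<phi> y) =
      psh_code (und X) (\<theta>\<^sub>0 (arr Y y)) (\<lambda>x\<in>und X. base_rel \<theta> X Y \<phi> x y)" if y: "y \<in> und Y" for y
    using y Q.psh_of_rel_in_psh_set[OF assms y] assms(1)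
    by (simp add: base_psh_def Q.psh_val_of_rel base_rel_apply cong: restrict_cong)
  then show ?thesis
    unfolding compose_def psh_of_rel_def[of "B X"] by (auto intro!: restrict_ext)
qed

text \<open>
  The map \<open>\<theta>\<^sub>X\<close> itself is named by the image of the evaluation relation, because evaluation names the
  identity. This makes \<open>\<theta>\<^sub>X\<close> a map into the presheaves over \<open>R\<close>.
\<close>

lemma base_psh_eq_of_rel:
  assumes X: "X \<in> slice_ob Q"
  shows "base_psh Q \<theta>\<^sub>0 \<theta> X = psh_of_rel (B X) (B (psh Q X)) (base_rel \<theta> X (psh Q X) (eval_rel Q X))"
proof -
  have "compose (psh_set Q X) (base_psh Q \<theta>\<^sub>0 \<theta> X) (\<lambda>p\<in>psh_set Q X. p) = base_psh Q \<theta>\<^sub>0 \<theta> X"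
    by (auto simp: compose_def base_psh_def)
  then show ?thesis
    using base_psh_compose_of_rel[OF X Q.psh_slice_ob[OF X] Q.eval_rel_in_qrels[OF X]]
    by (simp add: Q.psh_of_eval_rel[OF X])
qed

end

lemma psh_le_reindex:
  assumes "psh_le R X Z f g" and "\<And>t. t \<in> W \<Longrightarrow> h t \<in> Z"
    and "\<And>t. t \<in> W \<Longrightarrow> f' t = f (h t)" and "\<And>t. t \<in> W \<Longrightarrow> g' t = g (h t)"
  shows "psh_le R X W f' g'"
  unfolding psh_le_def
proof
  fix t assume t: "t \<in> W"
  show "psh_arr (f' t) = psh_arr (g' t) \<and>
      (\<forall>x\<in>und X. qle R (arr X x) (psh_arr (f' t)) (psh_val (f' t) x) (psh_val (g' t) x))"
    unfolding assms(3,4)[OF t]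
    by (rule assms(1)[unfolded psh_le_def, THEN bspec, OF assms(2)[OF t]])
qed

locale base_change_of_extensions =
  Q: law_extension Q T \<zeta> E \<Lambda> + R: law_extension R T \<eta> F \<kappa> + base_change Q R \<theta>\<^sub>0 \<theta>
  for Q R :: "'v::grothendieck_universe quantaloid" and T \<zeta> \<eta> E F \<Lambda> \<kappa> \<theta>\<^sub>0 \<theta> +
  assumes algebra_hom: "monad_hom T (Ob Q) \<zeta> (Ob R) \<eta> \<theta>\<^sub>0"
begin

text \<open>
  Both objects have underlying set \<open>T X\<close>; their arrays agree because \<open>\<theta>\<^sub>0\<close> is a homomorphism of
  algebras.
\<close>

lemma lift_base:
  assumes X: "X \<in> slice_ob Q"
  shows "R.L (B X) = B (Q.L X)"
proof -
  note small = Q.slice_ob_small[OF X] Q.Ob_small R.Ob_small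
  note a = Q.arr_extensional[OF X]
  have "\<eta> (TMap T (und X) (Ob R) (compose (und X) \<theta>\<^sub>0 (arr X)) t) =
      \<theta>\<^sub>0 (\<zeta> (TMap T (und X) (Ob Q) (arr X) t))" if t: "t \<in> TOb T (und X)" for t
  proof -
    have Tt: "TMap T (und X) (Ob Q) (arr X) t \<in> TOb T (Ob Q)"
      using Q.TMap_closed[OF small(1,2) a] t by auto
    have "compose (TOb T (Ob Q)) \<theta>\<^sub>0 \<zeta> = compose (TOb T (Ob Q)) \<eta> (TMap T (Ob Q) (Ob R) \<theta>\<^sub>0)"
      using algebra_hom by (simp add: monad_hom_def)
    from fun_cong[OF this, of "TMap T (und X) (Ob Q) (arr X) t"] show ?thesis
      using Tt Q.TMap_compose[OF small a object_map_extensional t] by (simp add: compose_eq)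
  qed
  then show ?thesis
    unfolding lift_ob_def base_ob_def compose_def by (auto intro!: restrict_ext)
qed

lemma ext_compatible_iff:
  "ext_compatible T Q R \<zeta> \<eta> \<theta>\<^sub>0 \<theta> E F \<longleftrightarrow> (\<forall>X\<in>slice_ob Q. \<forall>Y\<in>slice_ob Q. \<forall>\<phi>\<in>qrels Q X Y.
    qrel_le R (R.L (B X)) (R.L (B Y))
      (F (B X) (B Y) (base_rel \<theta> X Y \<phi>)) (base_rel \<theta> (Q.L X) (Q.L Y) (E X Y \<phi>)))"
  by (simp add: ext_compatible_def Let_def)

lemma law_compatible_iff:
  "law_compatible T Q R \<zeta> \<eta> \<theta>\<^sub>0 \<theta> \<Lambda> \<kappa> \<longleftrightarrow> (\<forall>X\<in>slice_ob Q.
    psh_le R (R.L (B X)) (TOb T (psh_set Q X))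
      (compose (TOb T (psh_set Q X)) (\<kappa> (B X)) (TMap T (psh_set Q X) (psh_set R (B X)) (base_psh Q \<theta>\<^sub>0 \<theta> X)))
      (compose (TOb T (psh_set Q X)) (base_psh Q \<theta>\<^sub>0 \<theta> (Q.L X)) (\<Lambda> X)))"
  by (simp add: law_compatible_def Let_def)

text \<open>
  The next two lemmas turn the sides of the compatibility condition for extensions into maps into
  presheaves over \<open>R\<close>, where they can be compared with those of the condition for laws.
\<close>

lemma psh_of_extension_base:
  assumes "X \<in> slice_ob Q" "Y \<in> slice_ob Q" "\<phi> \<in> qrels Q X Y"
  shows "psh_of_rel (R.L (B X)) (R.L (B Y)) (F (B X) (B Y) (base_rel \<theta> X Y \<phi>)) =
    compose (TOb T (und Y)) (\<kappa> (B X)) (TMap T (und Y) (psh_set R (B X))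
      (compose (und Y) (base_psh Q \<theta>\<^sub>0 \<theta> X) (psh_of_rel X Y \<phi>)))"
  using R.psh_of_rel_extension[OF base_slice_ob[OF assms(1)] base_slice_ob[OF assms(2)]
      base_rel_in_qrels[OF assms]]
  by (simp add: base_psh_compose_of_rel[OF assms])

lemma psh_of_base_extension:
  assumes "X \<in> slice_ob Q" "Y \<in> slice_ob Q" "\<phi> \<in> qrels Q X Y"
  shows "psh_of_rel (R.L (B X)) (R.L (B Y)) (base_rel \<theta> (Q.L X) (Q.L Y) (E X Y \<phi>)) =
    compose (TOb T (und Y)) (base_psh Q \<theta>\<^sub>0 \<theta> (Q.L X)) (psh_of_rel (Q.L X) (Q.L Y) (E X Y \<phi>))"
  using base_psh_compose_of_rel[OF Q.lift_slice_ob[OF assms(1)] Q.lift_slice_ob[OF assms(2)]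
      Q.extension_in_qrels[OF assms]]
  by (simp add: lift_base assms(1,2))

lemma ext_compatible_at_iff:
  assumes "X \<in> slice_ob Q" "Y \<in> slice_ob Q" "\<phi> \<in> qrels Q X Y"
  shows "qrel_le R (R.L (B X)) (R.L (B Y))
      (F (B X) (B Y) (base_rel \<theta> X Y \<phi>)) (base_rel \<theta> (Q.L X) (Q.L Y) (E X Y \<phi>)) \<longleftrightarrow>
    psh_le R (R.L (B X)) (TOb T (und Y))
      (compose (TOb T (und Y)) (\<kappa> (B X)) (TMap T (und Y) (psh_set R (B X))
        (compose (und Y) (base_psh Q \<theta>\<^sub>0 \<theta> X) (psh_of_rel X Y \<phi>))))
      (compose (TOb T (und Y)) (base_psh Q \<theta>\<^sub>0 \<theta> (Q.L X)) (psh_of_rel (Q.L X) (Q.L Y) (E X Y \<phi>)))"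
  using R.psh_le_of_rel_iff[OF R.lift_slice_ob[OF base_slice_ob[OF assms(1)]], of "R.L (B Y)"]
  unfolding psh_of_extension_base[OF assms, symmetric] psh_of_base_extension[OF assms, symmetric]
  by simp

text \<open>
  The condition for laws is the condition for extensions at the evaluation relation. Conversely a
  relation \<open>\<phi>\<close> names a map \<open>f\<close> from \<open>Y\<close> to the presheaves on \<open>X\<close>, and its condition is the one for
  evaluation restricted along \<open>T f\<close>.
\<close>

lemma compatible_iff:
  "ext_compatible T Q R \<zeta> \<eta> \<theta>\<^sub>0 \<theta> E F \<longleftrightarrow> law_compatible T Q R \<zeta> \<eta> \<theta>\<^sub>0 \<theta> \<Lambda> \<kappa>"
proof
  assume ext: "ext_compatible T Q R \<zeta> \<eta> \<theta>\<^sub>0 \<theta> E F"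
  show "law_compatible T Q R \<zeta> \<eta> \<theta>\<^sub>0 \<theta> \<Lambda> \<kappa>"
    unfolding law_compatible_iff
  proof
    fix X assume X: "X \<in> slice_ob Q"
    note \<epsilon> = X Q.psh_slice_ob[OF X] Q.eval_rel_in_qrels[OF X]
    have "compose (und (psh Q X)) (base_psh Q \<theta>\<^sub>0 \<theta> X) (psh_of_rel X (psh Q X) (eval_rel Q X)) =
        base_psh Q \<theta>\<^sub>0 \<theta> X"
      unfolding base_psh_compose_of_rel[OF \<epsilon>] by (rule base_psh_eq_of_rel[OF X, symmetric])
    then show "psh_le R (R.L (B X)) (TOb T (psh_set Q X))
      (compose (TOb T (psh_set Q X)) (\<kappa> (B X)) (TMap T (psh_set Q X) (psh_set R (B X)) (base_psh Q \<theta>\<^sub>0 \<theta> X)))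
      (compose (TOb T (psh_set Q X)) (base_psh Q \<theta>\<^sub>0 \<theta> (Q.L X)) (\<Lambda> X))"
      using ext[unfolded ext_compatible_iff, rule_format, OF \<epsilon>, unfolded ext_compatible_at_iff[OF \<epsilon>]]
      by (simp add: Q.law_eq[OF X])
  qed
next
  assume law: "law_compatible T Q R \<zeta> \<eta> \<theta>\<^sub>0 \<theta> \<Lambda> \<kappa>"
  show "ext_compatible T Q R \<zeta> \<eta> \<theta>\<^sub>0 \<theta> E F"
    unfolding ext_compatible_iff
  proof (intro ballI)
    fix X Y \<phi> assume X: "X \<in> slice_ob Q" and Y: "Y \<in> slice_ob Q" and \<phi>: "\<phi> \<in> qrels Q X Y"
    let ?f = "psh_of_rel X Y \<phi>"
    let ?\<theta>X = "base_psh Q \<theta>\<^sub>0 \<theta> X"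
    have f: "?f \<in> und Y \<rightarrow>\<^sub>E psh_set Q X"
      using Q.slice_hom_extensional[OF Q.psh_of_rel_slice_hom[OF X Y \<phi>]] by simp
    have \<theta>X: "?\<theta>X \<in> psh_set Q X \<rightarrow>\<^sub>E psh_set R (B X)"
      using R.slice_hom_extensional[OF R.psh_of_rel_slice_hom[OF base_slice_ob[OF X]
          base_slice_ob[OF Q.psh_slice_ob[OF X]]
          base_rel_in_qrels[OF X Q.psh_slice_ob[OF X] Q.eval_rel_in_qrels[OF X]]]]
      by (simp add: base_psh_eq_of_rel[OF X])
    have small: "small (und Y)" "small (psh_set Q X)" "small (psh_set R (B X))"
      using Q.slice_ob_small[OF Y] small_psh_set[OF Q.quantaloid X]
        small_psh_set[OF R.quantaloid base_slice_ob[OF X]] by auto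
    have Tf: "TMap T (und Y) (psh_set Q X) ?f t \<in> TOb T (psh_set Q X)" if "t \<in> TOb T (und Y)" for t
      using Q.TMap_closed[OF small(1,2) f] that by auto
    have "psh_le R (R.L (B X)) (TOb T (und Y))
      (compose (TOb T (und Y)) (\<kappa> (B X)) (TMap T (und Y) (psh_set R (B X)) (compose (und Y) ?\<theta>X ?f)))
      (compose (TOb T (und Y)) (base_psh Q \<theta>\<^sub>0 \<theta> (Q.L X)) (psh_of_rel (Q.L X) (Q.L Y) (E X Y \<phi>)))"
    proof (rule psh_le_reindex[OF law[unfolded law_compatible_iff, rule_format, OF X] Tf])
      fix t assume t: "t \<in> TOb T (und Y)"
      show "compose (TOb T (und Y)) (\<kappa> (B X)) (TMap T (und Y) (psh_set R (B X)) (compose (und Y) ?\<theta>X ?f)) t =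
          compose (TOb T (psh_set Q X)) (\<kappa> (B X)) (TMap T (psh_set Q X) (psh_set R (B X)) ?\<theta>X)
            (TMap T (und Y) (psh_set Q X) ?f t)"
        using t Tf[OF t] Q.TMap_compose[OF small f \<theta>X t] by (simp add: compose_eq)
      show "compose (TOb T (und Y)) (base_psh Q \<theta>\<^sub>0 \<theta> (Q.L X)) (psh_of_rel (Q.L X) (Q.L Y) (E X Y \<phi>)) t =
          compose (TOb T (psh_set Q X)) (base_psh Q \<theta>\<^sub>0 \<theta> (Q.L X)) (\<Lambda> X)
            (TMap T (und Y) (psh_set Q X) ?f t)"
        using t Tf[OF t] by (simp add: Q.psh_of_rel_extension[OF X Y \<phi>] compose_eq)
    qed
    then show "qrel_le R (R.L (B X)) (R.L (B Y))
        (F (B X) (B Y) (base_rel \<theta> X Y \<phi>)) (base_rel \<theta> (Q.L X) (Q.L Y) (E X Y \<phi>))"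
      by (simp only: ext_compatible_at_iff[OF X Y \<phi>])
  qed
qed

abbreviation base where "base \<equiv> base_cat T Q \<zeta> \<theta>\<^sub>0 \<theta>"

lemma base_eq: "base (X, \<alpha>) = (B X, base_rel \<theta> X (Q.L X) \<alpha>)"
  by (simp add: base_cat_def)

lemma base_lift_rel_in_qrels:
  assumes "X \<in> slice_ob Q" "\<alpha> \<in> qrels Q X (Q.L X)"
  shows "base_rel \<theta> X (Q.L X) \<alpha> \<in> qrels R (B X) (R.L (B X))"
  unfolding lift_base[OF assms(1)] using assms by (intro base_rel_in_qrels Q.lift_slice_ob)

text \<open>
  Reflexivity uses \<open>1 \<le> \<theta> 1 \<le> \<theta>(\<alpha>(x, e x))\<close>. Transitivity is the chain
  \<open>F(\<theta> \<alpha>)(t, s) \<circ> \<theta>(\<alpha>(x, t)) \<le> \<theta>(E \<alpha>(t, s)) \<circ> \<theta>(\<alpha>(x, t))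
    \<le> \<theta>(E \<alpha>(t, s) \<circ> \<alpha>(x, t)) \<le> \<theta>(\<alpha>(x, m s))\<close>,
  whose first step is the compatibility of the extensions.
\<close>

lemma base_Obj:
  assumes comp: "ext_compatible T Q R \<zeta> \<eta> \<theta>\<^sub>0 \<theta> E F" and object: "A \<in> Obj Q.Cat"
  shows "base A \<in> Obj R.Cat"
proof -
  obtain X \<alpha> where A: "A = (X, \<alpha>)" by (cases A)
  have X: "X \<in> slice_ob Q" and \<alpha>: "\<alpha> \<in> qrels Q X (Q.L X)"
    and refl: "\<And>x. x \<in> und X \<Longrightarrow> qle Q (arr X x) (arr X x) (One Q (arr X x)) (\<alpha> x (munit T (und X) x))"
    and trans: "\<And>x t s. x \<in> und X \<Longrightarrow> t \<in> und (Q.L X) \<Longrightarrow> s \<in> und (Q.L (Q.L X)) \<Longrightarrow>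
      qle Q (arr X x) (arr (Q.L (Q.L X)) s)
       (Comp Q (arr X x) (arr (Q.L X) t) (arr (Q.L (Q.L X)) s) (E X (Q.L X) \<alpha> t s) (\<alpha> x t))
       (\<alpha> x (mmult T (und X) s))"
    using object unfolding A Q.Obj_Cat_pointwise_iff by blast+
  note LX = Q.lift_slice_ob[OF X] and LLX = Q.lift_slice_ob[OF Q.lift_slice_ob[OF X]]
  note lift = lift_base[OF X] lift_base[OF LX]
  let ?\<alpha> = "base_rel \<theta> X (Q.L X) \<alpha>"
  show ?thesis
    unfolding A base_eq R.Obj_Cat_pointwise_iff
  proof (intro conjI ballI base_slice_ob[OF X] base_lift_rel_in_qrels[OF X \<alpha>])
    fix x assume "x \<in> und (B X)"
    then have x: "x \<in> und X" by simp
    note ax = Q.arr_closed[OF X x]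
    note ex = Q.slice_homD[OF Q.munit_slice_hom[OF X] x]
    have \<alpha>x: "\<alpha> x (munit T (und X) x) \<in> carrier (Hom Q (arr X x) (arr X x))"
      using Q.qrels_closed[OF \<alpha> x ex(1)] ex(2) by simp
    have "qle R (\<theta>\<^sub>0 (arr X x)) (\<theta>\<^sub>0 (arr X x)) (One R (\<theta>\<^sub>0 (arr X x)))
        (\<theta> (arr X x) (arr X x) (\<alpha> x (munit T (und X) x)))"
      by (rule R.qle_trans[OF _ _ One_le_hom_map[OF ax] hom_map_mono[OF ax ax _ \<alpha>x refl[OF x]]])
        (use ax \<alpha>x in auto)
    then show "qle R (arr (B X) x) (arr (B X) x) (One R (arr (B X) x)) (?\<alpha> x (munit T (und (B X)) x))"
      using x ex by (simp add: base_rel_apply)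
  next
    fix x t s assume "x \<in> und (B X)" "t \<in> und (R.L (B X))" "s \<in> und (R.L (R.L (B X)))"
    then have x: "x \<in> und X" and t: "t \<in> und (Q.L X)" and s: "s \<in> und (Q.L (Q.L X))" by simp_all
    \<comment> \<open>Short names for the entries \<open>u\<close>, \<open>v\<close>, \<open>v'\<close>, \<open>w\<close> in the chain and for their objects:
      over \<open>Q\<close> these are \<open>u : a \<rightarrow> b\<close>, \<open>v : b \<rightarrow> c\<close> and \<open>w : a \<rightarrow> c\<close>.\<close>
    define a b c where "a = arr X x" and "b = arr (Q.L X) t" and "c = arr (Q.L (Q.L X)) s"
    have ob: "a \<in> Ob Q" "b \<in> Ob Q" "c \<in> Ob Q"
      unfolding a_def b_def c_def by (rule Q.arr_closed[OF X x] Q.arr_closed[OF LX t] Q.arr_closed[OF LLX s])+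
    note ms = Q.slice_homD[OF Q.mmult_slice_hom[OF X] s]
    define u v w where "u = \<alpha> x t" and "v = E X (Q.L X) \<alpha> t s" and "w = \<alpha> x (mmult T (und X) s)"
    have u: "u \<in> carrier (Hom Q a b)"
      unfolding u_def a_def b_def by (rule Q.qrels_closed[OF \<alpha> x t])
    have v: "v \<in> carrier (Hom Q b c)"
      unfolding v_def b_def c_def by (rule Q.qrels_closed[OF Q.extension_in_qrels[OF X LX \<alpha>] t s])
    have w: "w \<in> carrier (Hom Q a c)"
      using Q.qrels_closed[OF \<alpha> x ms(1)] ms(2) by (simp add: w_def a_def c_def)
    define v' where "v' = F (B X) (R.L (B X)) ?\<alpha> t s"
    have arrs: "arr (B X) x = \<theta>\<^sub>0 a" "arr (R.L (B X)) t = \<theta>\<^sub>0 b" "arr (R.L (R.L (B X))) s = \<theta>\<^sub>0 c"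
      unfolding lift a_def b_def c_def using x t s by (simp_all del: Q.und_lift)
    have v': "v' \<in> carrier (Hom R (\<theta>\<^sub>0 b) (\<theta>\<^sub>0 c))"
      using R.qrels_closed[OF R.extension_in_qrels[OF base_slice_ob[OF X]
          R.lift_slice_ob[OF base_slice_ob[OF X]] base_lift_rel_in_qrels[OF X \<alpha>]], of t s] t s arrs
      by (simp add: v'_def)
    have v'_le: "qle R (\<theta>\<^sub>0 b) (\<theta>\<^sub>0 c) v' (\<theta> b c v)"
    proof -
      have ts: "t \<in> und (R.L (B X))" "s \<in> und (R.L (B (Q.L X)))" using t s by simp_all
      have "qle R (arr (R.L (B X)) t) (arr (R.L (B (Q.L X))) s)
          (F (B X) (B (Q.L X)) ?\<alpha> t s) (base_rel \<theta> (Q.L X) (Q.L (Q.L X)) (E X (Q.L X) \<alpha>) t s)"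
        using comp[unfolded ext_compatible_iff, rule_format, OF X LX \<alpha>] ts
        unfolding qrel_le_def by blast
      then show ?thesis
        using arrs t s unfolding v'_def v_def lift b_def c_def by (simp add: base_rel_apply)
    qed
    have "qle R (\<theta>\<^sub>0 a) (\<theta>\<^sub>0 c) (Comp R (\<theta>\<^sub>0 a) (\<theta>\<^sub>0 b) (\<theta>\<^sub>0 c) v' (\<theta> a b u)) (\<theta> a c w)"
    proof (rule R.qle_trans)
      show "qle R (\<theta>\<^sub>0 a) (\<theta>\<^sub>0 c) (Comp R (\<theta>\<^sub>0 a) (\<theta>\<^sub>0 b) (\<theta>\<^sub>0 c) v' (\<theta> a b u))
          (Comp R (\<theta>\<^sub>0 a) (\<theta>\<^sub>0 b) (\<theta>\<^sub>0 c) (\<theta> b c v) (\<theta> a b u))"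
        using ob u v v' v'_le by (intro R.Comp_mono_left) auto
      show "qle R (\<theta>\<^sub>0 a) (\<theta>\<^sub>0 c) (Comp R (\<theta>\<^sub>0 a) (\<theta>\<^sub>0 b) (\<theta>\<^sub>0 c) (\<theta> b c v) (\<theta> a b u)) (\<theta> a c w)"
      proof (rule R.qle_trans)
        show "qle R (\<theta>\<^sub>0 a) (\<theta>\<^sub>0 c) (Comp R (\<theta>\<^sub>0 a) (\<theta>\<^sub>0 b) (\<theta>\<^sub>0 c) (\<theta> b c v) (\<theta> a b u))
            (\<theta> a c (Comp Q a b c v u))"
          by (rule Comp_le_hom_map[OF ob u v])
        show "qle R (\<theta>\<^sub>0 a) (\<theta>\<^sub>0 c) (\<theta> a c (Comp Q a b c v u)) (\<theta> a c w)"
          using trans[OF x t s] ob u v w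
          by (intro hom_map_mono) (auto simp: a_def b_def c_def u_def v_def w_def)
      qed (use ob u v w in auto)
    qed (use ob u v v' w in auto)
    then show "qle R (arr (B X) x) (arr (R.L (R.L (B X))) s)
       (Comp R (arr (B X) x) (arr (R.L (B X)) t) (arr (R.L (R.L (B X))) s)
         (F (B X) (R.L (B X)) ?\<alpha> t s) (?\<alpha> x t))
       (?\<alpha> x (mmult T (und (B X)) s))"
      using x t s ms unfolding arrs
      by (simp add: base_rel_apply v'_def u_def w_def a_def b_def c_def)
  qed
qed

lemma base_Mor:
  assumes objects: "A \<in> Obj Q.Cat" "A' \<in> Obj Q.Cat" and f: "f \<in> Mor Q.Cat A A'"
  shows "f \<in> Mor R.Cat (base A) (base A')"
proof -
  obtain X \<alpha> Y \<beta> where A: "A = (X, \<alpha>)" "A' = (Y, \<beta>)"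
    by (cases A; cases A')
  have ob: "X \<in> slice_ob Q" "Y \<in> slice_ob Q"
    and rel: "\<alpha> \<in> qrels Q X (Q.L X)" "\<beta> \<in> qrels Q Y (Q.L Y)"
    using objects by (simp_all add: A Q.Obj_Cat_iff)
  have f': "f \<in> slice_hom X Y" and fle: "\<And>x t. x \<in> und X \<Longrightarrow> t \<in> und (Q.L X) \<Longrightarrow>
      qle Q (arr X x) (arr (Q.L X) t) (\<alpha> x t) (\<beta> (f x) (Tm T X Y f t))"
    using f unfolding A Q.Mor_Cat_pointwise_iff[OF ob rel] by auto
  have "qle R (arr (B X) x) (arr (R.L (B X)) t) (base_rel \<theta> X (Q.L X) \<alpha> x t)
      (base_rel \<theta> Y (Q.L Y) \<beta> (f x) (Tm T (B X) (B Y) f t))"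
    if "x \<in> und (B X)" "t \<in> und (R.L (B X))" for x t
  proof -
    have x: "x \<in> und X" and t: "t \<in> und (Q.L X)" using that by simp_all
    note fx = Q.slice_homD[OF f' x]
    note ft = Q.slice_homD[OF Q.lift_slice_hom[OF ob f'] t]
    have "\<beta> (f x) (Tm T X Y f t) \<in> carrier (Hom Q (arr X x) (arr (Q.L X) t))"
      using Q.qrels_closed[OF rel(2) fx(1) ft(1)] fx(2) ft(2) by simp
    then have "qle R (\<theta>\<^sub>0 (arr X x)) (\<theta>\<^sub>0 (arr (Q.L X) t)) (\<theta> (arr X x) (arr (Q.L X) t) (\<alpha> x t))
        (\<theta> (arr X x) (arr (Q.L X) t) (\<beta> (f x) (Tm T X Y f t)))"
      by (intro hom_map_mono fle Q.qrels_closed[OF rel(1)] Q.arr_closed[OF ob(1)]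
          Q.arr_closed[OF Q.lift_slice_ob[OF ob(1)]] x t)
    then show ?thesis
      unfolding lift_base[OF ob(1)] using x t fx ft by (simp add: base_rel_apply)
  qed
  then show ?thesis
    unfolding A base_eq R.Mor_Cat_pointwise_iff[OF base_slice_ob[OF ob(1)] base_slice_ob[OF ob(2)]
        base_lift_rel_in_qrels[OF ob(1) rel(1)] base_lift_rel_in_qrels[OF ob(2) rel(2)]]
    using base_slice_hom[OF f'] by blast
qed

lemma base_functor:
  assumes "ext_compatible T Q R \<zeta> \<eta> \<theta>\<^sub>0 \<theta> E F"
  shows "is_functor Q.Cat R.Cat base (\<lambda>_ _ f. f)"
proof -
  have "und (fst (base A)) = und (fst A)" for A
    by (cases A) (simp add: base_eq)
  then show ?thesis
    unfolding is_functor_def Q.Idt_Cat R.Idt_Cat Q.Cps_Cat R.Cps_Cat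
    by (simp add: Q.is_category_Cat R.is_category_Cat base_Obj[OF assms] base_Mor)
qed

lemma base_square:
  assumes "A \<in> Obj Q.Cat"
  shows "cat_to_alg T R \<eta> (base A) = base_alg T Q \<zeta> \<theta>\<^sub>0 \<theta> (cat_to_alg T Q \<zeta> A)"
proof (cases A)
  case (Pair X \<alpha>)
  then have X: "X \<in> slice_ob Q" and \<alpha>: "\<alpha> \<in> qrels Q X (Q.L X)"
    using assms by (simp_all add: Q.Obj_Cat_iff)
  show ?thesis
    unfolding Pair using base_psh_compose_of_rel[OF X Q.lift_slice_ob[OF X] \<alpha>]
    by (simp add: base_eq cat_to_alg_def base_alg_def lift_base[OF X])
qed

lemma base_alg_functor:
  assumes "law_compatible T Q R \<zeta> \<eta> \<theta>\<^sub>0 \<theta> \<Lambda> \<kappa>"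
  shows "is_functor Q.Alg R.Alg (base_alg T Q \<zeta> \<theta>\<^sub>0 \<theta>) (\<lambda>_ _ f. f)"
  using base_functor Q.cat_to_alg_isomorphism R.cat_to_alg_isomorphism
  by (rule is_functor_transport) (use assms compatible_iff base_square in auto)

end

theorem proposition7p4:
  fixes T :: "'v::grothendieck_universe monad"
    and Q R :: "'v quantaloid"
    and \<zeta> \<eta> \<theta>\<^sub>0 :: "'v \<Rightarrow> 'v"
    and \<theta> :: "'v \<Rightarrow> 'v \<Rightarrow> 'v \<Rightarrow> 'v"
    and E F :: "'v ob \<Rightarrow> 'v ob \<Rightarrow> 'v qrel \<Rightarrow> 'v qrel"
    and \<Lambda> \<kappa> :: "'v ob \<Rightarrow> 'v \<Rightarrow> 'v"
  assumes "small_quantaloid Q" and "small_quantaloid R"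
    and "lax_hom Q R \<theta>\<^sub>0 \<theta>"
    and "set_monad T"
    and "monad_algebra T (Ob Q) \<zeta>" and "monad_algebra T (Ob R) \<eta>"
    and "monad_hom T (Ob Q) \<zeta> (Ob R) \<eta> \<theta>\<^sub>0"
    and "lax_extension T Q \<zeta> E" and "lax_extension T R \<eta> F"
    and "monotone_distributive_law T Q \<zeta> \<Lambda>" and "monotone_distributive_law T R \<eta> \<kappa>"
    and "law_extension_correspond T Q \<zeta> E \<Lambda>" and "law_extension_correspond T R \<eta> F \<kappa>"
  shows
    "(ext_compatible T Q R \<zeta> \<eta> \<theta>\<^sub>0 \<theta> E F \<longrightarrow>
        is_functor (tqcat T Q \<zeta> E) (tqcat T R \<eta> F) (base_cat T Q \<zeta> \<theta>\<^sub>0 \<theta>) (\<lambda>_ _ f. f)) \<and>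
     (ext_compatible T Q R \<zeta> \<eta> \<theta>\<^sub>0 \<theta> E F \<longleftrightarrow> law_compatible T Q R \<zeta> \<eta> \<theta>\<^sub>0 \<theta> \<Lambda> \<kappa>) \<and>
     is_cat_isomorphism (tqcat T Q \<zeta> E) (alg_cat T Q \<zeta> \<Lambda>) (cat_to_alg T Q \<zeta>) (\<lambda>_ _ f. f) \<and>
     is_cat_isomorphism (tqcat T R \<eta> F) (alg_cat T R \<eta> \<kappa>) (cat_to_alg T R \<eta>) (\<lambda>_ _ f. f) \<and>
     (law_compatible T Q R \<zeta> \<eta> \<theta>\<^sub>0 \<theta> \<Lambda> \<kappa> \<longrightarrow>
        is_functor (alg_cat T Q \<zeta> \<Lambda>) (alg_cat T R \<eta> \<kappa>) (base_alg T Q \<zeta> \<theta>\<^sub>0 \<theta>) (\<lambda>_ _ f. f) \<and>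
        (\<forall>A \<in> Obj (tqcat T Q \<zeta> E).
           cat_to_alg T R \<eta> (base_cat T Q \<zeta> \<theta>\<^sub>0 \<theta> A) = base_alg T Q \<zeta> \<theta>\<^sub>0 \<theta> (cat_to_alg T Q \<zeta> A)))"
proof -
  interpret base_change_of_extensions Q R T \<zeta> \<eta> E F \<Lambda> \<kappa> \<theta>\<^sub>0 \<theta>
    using assms by unfold_locales
  show ?thesis
    using base_functor compatible_iff Q.cat_to_alg_isomorphism R.cat_to_alg_isomorphism
      base_alg_functor base_square
    by blast
qed

end
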